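(* Let $1\le p\le\infty$, $m\ge1$, and let $k_1,\ldots,k_n$ be non-negative integers with $k_1+\cdots+k_n=m$. Then, if $p\ge m$, \[\frac{k_1!\cdots k_n!}{k_1^{k_1/p}\cdots k_n^{k_n/p}}\,\frac{m^{m/p}}{m!}\le c_p(k_1,\ldots,k_n)\le \min\left\{\frac{k_1^{k_1}\cdots k_n^{k_n}}{m!}\,n^{m/p},\ \frac{p\,2^{p/2}\Gamma(p/2)\,m^{p/2}}{m!}\right\},\] and, if $p<m$, \[\frac{k_1!\cdots k_n!}{k_1^{k_1/p}\cdots k_n^{k_n/p}}\,\frac{m^{m/p}}{m!}\le c_p(k_1,\ldots,k_n)\le \min\left\{\frac{k_1^{k_1}\cdots k_n^{k_n}}{m!}\,n^{m/p},\ \frac{n^{(m-p)/p}\,m\,2^{m/2}\Gamma(m/2)\,m^{m/2}}{m!}\right\}.\]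
   Context: $c_p(k_1,\ldots,k_n)$ denotes the smallest constant $c$ such that for every continuous symmetric $m$-linear form $L:(\ell_p)^m\to\mathbb{R}$ on real $\ell_p$ and all norm-one vectors $x_1,\ldots,x_n\in\ell_p$ with pairwise disjoint supports, $|L(x_1^{k_1}\cdots x_n^{k_n})|\le c\,\|\widehat L\|$. Here $\widehat{L}(x)=L(x,\ldots,x)$, $\|\widehat{L}\|=\sup\{|\widehat{L}(x)|:\|x\|_p\le1\}$, and $L(x_1^{k_1}\cdots x_n^{k_n})$ means $L$ evaluated at the $m$-tuple in which each $x_i$ appears $k_i$ times. Conventions: $0^0=1$, $0!=1$; when $p=\infty$, $k^{k/p}=1$, $m^{m/p}=n^{m/p}=1$, and $p\,2^{p/2}\Gamma(p/2)m^{p/2}$ is interpreted as $+\infty$. *)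

theory Defs
  imports "HOL-Analysis.Analysis"
begin

definition in_lp :: "ereal \<Rightarrow> (nat \<Rightarrow> real) \<Rightarrow> bool" where
  "in_lp p x = (if p = \<infinity> then bounded (range x)
                else summable (\<lambda>i. \<bar>x i\<bar> powr real_of_ereal p))"

definition lp_norm :: "ereal \<Rightarrow> (nat \<Rightarrow> real) \<Rightarrow> real" where
  "lp_norm p x = (if p = \<infinity> then (SUP i. \<bar>x i\<bar>)
                  else (\<Sum>i. \<bar>x i\<bar> powr real_of_ereal p) powr (1 / real_of_ereal p))"

text \<open>An m-linear form is modelled as a function on lists of length m of vectors;
  only its values on tuples of l_p vectors matter.\<close>

definition sym_mlin_form :: "ereal \<Rightarrow> nat \<Rightarrow> ((nat \<Rightarrow> real) list \<Rightarrow> real) \<Rightarrow> bool" where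
  "sym_mlin_form p m L \<longleftrightarrow>
     \<comment> \<open>linear in each argument\<close>
     (\<forall>i<m. \<forall>xs x y (a::real) (b::real).
        length xs = m \<and> (\<forall>z\<in>set xs. in_lp p z) \<and> in_lp p x \<and> in_lp p y \<longrightarrow>
        L (xs[i := (\<lambda>t. a * x t + b * y t)]) = a * L (xs[i := x]) + b * L (xs[i := y])) \<and>
     \<comment> \<open>symmetric\<close>
     (\<forall>xs ys. length xs = m \<and> (\<forall>z\<in>set xs. in_lp p z) \<and> mset ys = mset xs \<longrightarrow> L ys = L xs) \<and>
     \<comment> \<open>continuous (equivalently bounded)\<close>
     (\<exists>C. \<forall>xs. length xs = m \<and> (\<forall>z\<in>set xs. in_lp p z) \<longrightarrow>
        \<bar>L xs\<bar> \<le> C * prod_list (map (lp_norm p) xs))"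

definition poly_norm :: "ereal \<Rightarrow> nat \<Rightarrow> ((nat \<Rightarrow> real) list \<Rightarrow> real) \<Rightarrow> real" where
  "poly_norm p m L = Sup {\<bar>L (replicate m x)\<bar> | x. in_lp p x \<and> lp_norm p x \<le> 1}"

definition rep_tuple :: "nat \<Rightarrow> (nat \<Rightarrow> nat) \<Rightarrow> (nat \<Rightarrow> nat \<Rightarrow> real) \<Rightarrow> (nat \<Rightarrow> real) list" where
  "rep_tuple n k x = concat (map (\<lambda>i. replicate (k i) (x i)) [0..<n])"

definition cp :: "ereal \<Rightarrow> nat \<Rightarrow> (nat \<Rightarrow> nat) \<Rightarrow> real" where
  "cp p n k = Inf {c. \<forall>L x. sym_mlin_form p (\<Sum>i<n. k i) L \<and>
        (\<forall>i<n. in_lp p (x i) \<and> lp_norm p (x i) = 1) \<and>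
        (\<forall>i<n. \<forall>j<n. i \<noteq> j \<longrightarrow> (\<forall>t. x i t = 0 \<or> x j t = 0)) \<longrightarrow>
        \<bar>L (rep_tuple n k x)\<bar> \<le> c * poly_norm p (\<Sum>i<n. k i) L}"

definition ppow :: "ereal \<Rightarrow> real \<Rightarrow> real \<Rightarrow> real" where
  "ppow p a b = (if p = \<infinity> then 1 else if a = 0 \<and> b = 0 then 1
                 else a powr (b / real_of_ereal p))"

end

theory Submission
  imports Defs "HOL-Probability.Hoeffding" "HOL-Combinatorics.Multiset_Permutations"
begin

text \<open>
  Lower bound: the form whose diagonal is the monomial \<open>\<Prod>i<n. x i ^ k i\<close> takes the value
  \<open>(\<Prod>i<n. fact (k i)) / fact m\<close> at the unit vectors, while its norm is given by the weighted
  AM-GM inequality applied to \<open>\<bar>x i\<bar> powr p\<close>.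

  Upper bounds: by Rademacher polarization, \<open>fact m * L (rep_tuple n k x)\<close> is an average of
  signed values of the diagonal at \<open>\<Sum>i<n. s i * x i\<close>, where \<open>s i\<close> is a sum of \<open>k i\<close> independent
  signs. Disjointness of supports turns the norm of this vector into the \<open>\<ell>\<^sub>p\<close> norm of \<open>s\<close>.
  Replacing \<open>x i\<close> by \<open>x i / k i\<close> and using \<open>\<bar>s i\<bar> \<le> k i\<close> gives the first bound. The second
  comes from the moments of \<open>s i\<close>, estimated by integrating the sub-Gaussian tail of a sum of signs.
\<close>

section \<open>Sums of random signs\<close>

text \<open>The sample space of \<open>m\<close> independent fair signs. Expectations become sums
  over this set divided by \<open>2 ^ m\<close>, so the probabilistic argument is finite counting;
  extensionality of the functions keeps the set finite.\<close>

definition signs :: "nat \<Rightarrow> (nat \<Rightarrow> real) set" where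
  "signs m = {..<m} \<rightarrow>\<^sub>E {-1, 1}"

lemma finite_signs [simp]: "finite (signs m)"
  by (simp add: signs_def finite_PiE)

text \<open>Independence in finite form: multiplying out the two-term factors produces one summand
  per sign vector.\<close>

lemma sum_prod_signs:
  "(\<Sum>\<epsilon>\<in>signs m. \<Prod>j<m. f j (\<epsilon> j)) = (\<Prod>j<m. f j (-1) + f j (1::real) :: real)"
  unfolding signs_def by (subst prod_sum_PiE[symmetric]) auto

lemma card_signs: "real (card (signs m)) = 2 ^ m"
  using sum_prod_signs[of "\<lambda>_ _. 1" m] by simp

lemma signs_cases: "\<epsilon> \<in> signs m \<Longrightarrow> j < m \<Longrightarrow> \<epsilon> j = -1 \<or> \<epsilon> j = 1"
  by (auto simp: signs_def PiE_def Pi_def)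

text \<open>\<open>cosh x\<close> is the moment generating function of a fair sign, so this is
  Hoeffding's lemma for that variable; evenness of \<open>cosh\<close> handles negative
  \<open>x\<close>.\<close>

lemma cosh_le_exp_square: "cosh x \<le> exp (x\<^sup>2 / 2)" for x :: real
proof -
  have *: "cosh x \<le> exp (x\<^sup>2 / 2)" if "x \<ge> 0" for x :: real
  proof -
    \<comment> \<open>With parameter \<open>2 * x\<close> and weight \<open>1/2\<close> the left
      side simplifies to \<open>ln (cosh x)\<close>: the argument of \<open>ln\<close> is
      \<open>exp x * cosh x\<close>, and the linear term removes \<open>x\<close>.\<close>
    have "- (2 * x) * (1/2) + ln (1 + 1/2 * (exp (2 * x) - 1)) \<le> (2*x)\<^sup>2 / 8"
      by (rule Hoeffdings_lemma_aux) (use that in auto)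
    moreover have "1 + 1/2 * (exp (2 * x) - 1) = exp x * cosh x"
      by (simp add: cosh_field_def field_simps flip: exp_add)
    ultimately have "ln (cosh x) \<le> x\<^sup>2 / 2"
      by (simp add: ln_mult cosh_real_pos power2_eq_square)
    thus ?thesis by (metis cosh_real_pos exp_le_cancel_iff exp_ln)
  qed
  show ?thesis
    using *[of x] *[of "-x"] by (cases "x \<ge> 0") auto
qed

text \<open>By independence the sum factorises: each coordinate in \<open>G\<close> contributes
  \<open>2 * cosh l\<close>, every other coordinate contributes 2.\<close>

lemma exp_moment_signs:
  assumes "G \<subseteq> {..<m}"
  shows "(\<Sum>\<epsilon>\<in>signs m. exp (l * (\<Sum>j\<in>G. \<epsilon> j))) \<le> 2 ^ m * exp (l\<^sup>2 * real (card G) / 2)"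
proof -
  have fin: "finite G" using assms finite_subset by blast
  have "(\<Sum>\<epsilon>\<in>signs m. exp (l * (\<Sum>j\<in>G. \<epsilon> j)))
      = (\<Sum>\<epsilon>\<in>signs m. \<Prod>j<m. (\<lambda>j e. if j \<in> G then exp (l * e) else 1) j (\<epsilon> j))"
    using assms fin by (simp add: sum_distrib_left exp_sum prod.If_cases Int_absorb1)
  also have "\<dots> = (\<Prod>j<m. 2 * (if j \<in> G then cosh l else 1))"
    by (subst sum_prod_signs, rule prod.cong) (auto simp: cosh_field_def)
  also have "\<dots> = 2 ^ m * cosh l ^ card G"
    using assms fin by (simp add: prod.distrib prod.If_cases Int_absorb1)
  also have "\<dots> \<le> 2 ^ m * exp (l\<^sup>2 / 2) ^ card G"
    by (intro mult_left_mono power_mono cosh_le_exp_square) auto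
  finally show ?thesis by (simp flip: exp_of_nat_mult add: mult_ac)
qed

text \<open>The Chernoff bound. The factor 2 in front of the exponential accounts for the two tails,
  estimated with \<open>l\<close> and \<open>- l\<close>.\<close>

lemma tail_signs:
  assumes "G \<subseteq> {..<m}" "card G > 0" "t > 0"
  shows "real (card {\<epsilon>\<in>signs m. t \<le> \<bar>\<Sum>j\<in>G. \<epsilon> j\<bar>}) \<le> 2 ^ m * (2 * exp (- (t\<^sup>2 / (2 * real (card G)))))"
proof -
  define k where "k = real (card G)"
  have k: "k > 0" using assms by (simp add: k_def)
  \<comment> \<open>This value minimises the exponent
    \<open>l\<^sup>2 * k / 2 - l * t\<close>.\<close>
  define l where "l = t / k"
  have l: "l > 0" using k assms by (simp add: l_def)
  let ?s = "\<lambda>\<epsilon>. \<Sum>j\<in>G. \<epsilon> j :: real"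
  have "real (card {\<epsilon>\<in>signs m. t \<le> \<bar>?s \<epsilon>\<bar>}) * exp (l * t)
      = (\<Sum>\<epsilon>\<in>{\<epsilon>\<in>signs m. t \<le> \<bar>?s \<epsilon>\<bar>}. exp (l * t))" by simp
  also have "\<dots> \<le> (\<Sum>\<epsilon>\<in>{\<epsilon>\<in>signs m. t \<le> \<bar>?s \<epsilon>\<bar>}. exp (l * ?s \<epsilon>) + exp (- l * ?s \<epsilon>))"
  proof (rule sum_mono)
    fix \<epsilon> assume "\<epsilon> \<in> {\<epsilon>\<in>signs m. t \<le> \<bar>?s \<epsilon>\<bar>}"
    hence "t \<le> ?s \<epsilon> \<or> t \<le> - ?s \<epsilon>" by auto
    thus "exp (l * t) \<le> exp (l * ?s \<epsilon>) + exp (- l * ?s \<epsilon>)"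
    proof
      assume "t \<le> ?s \<epsilon>"
      hence "exp (l * t) \<le> exp (l * ?s \<epsilon>)" using l by simp
      thus ?thesis by (simp add: add_increasing2)
    next
      assume "t \<le> - ?s \<epsilon>"
      hence "l * t \<le> l * (- ?s \<epsilon>)" using l by (intro mult_left_mono) auto
      hence "exp (l * t) \<le> exp (- l * ?s \<epsilon>)" by simp
      thus ?thesis by (simp add: add_increasing)
    qed
  qed
  also have "\<dots> \<le> (\<Sum>\<epsilon>\<in>signs m. exp (l * ?s \<epsilon>) + exp (- l * ?s \<epsilon>))"
    by (rule sum_mono2) (auto intro!: add_nonneg_nonneg)
  also have "\<dots> \<le> 2 ^ m * (2 * exp (l\<^sup>2 * k / 2))"
    using exp_moment_signs[OF assms(1), of l] exp_moment_signs[OF assms(1), of "-l"]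
    by (simp add: sum.distrib k_def)
  finally have "real (card {\<epsilon>\<in>signs m. t \<le> \<bar>?s \<epsilon>\<bar>}) \<le> 2 ^ m * (2 * exp (l\<^sup>2 * k / 2)) / exp (l * t)"
    by (simp add: field_simps)
  also have "\<dots> = 2 ^ m * (2 * exp (l\<^sup>2 * k / 2 - l * t))"
    by (simp add: exp_diff)
  also have "l\<^sup>2 * k / 2 - l * t = - (t\<^sup>2 / (2 * k))"
    using k by (simp add: l_def field_simps power2_eq_square)
  finally show ?thesis by (simp add: k_def)
qed

section \<open>Moments of sign sums by integrating the tail\<close>

text \<open>The integrand is the derivative of \<open>u powr r\<close>, cut off at \<open>w\<close>.
  Writing the cut-off as an indicator gives all \<open>w\<close> the same domain of integration, so
  that a sum over sign vectors can be taken inside the integral.\<close>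

lemma has_integral_layer_cake:
  assumes "r > 0" "w \<ge> (0::real)"
  shows "((\<lambda>u. r * u powr (r - 1) * (if u \<in> {0..w} then 1 else 0)) has_integral w powr r) {0..}"
proof -
  have "((\<lambda>u. u powr (r - 1)) has_integral (w powr r / r)) {0..w}"
    using has_integral_powr_from_0[of "r - 1" w] assms by simp
  hence "((\<lambda>u. if u \<in> {0..w} then u powr (r - 1) else 0) has_integral (w powr r / r)) {0..}"
    by (subst has_integral_restrict) auto
  from has_integral_mult_right[OF this, of r] show ?thesis
    using assms by (auto simp: if_distrib mult.assoc cong: if_cong)
qed

text \<open>The layer-cake formula is applied to the normalised square
  \<open>w = s\<^sup>2 / (2 * k)\<close>, whose tail beyond \<open>u\<close> has probability at most
  \<open>2 * exp (- u)\<close>. Integration against \<open>r * u powr (r - 1)\<close> with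
  \<open>r = q / 2\<close> gives \<open>2 * r * Gamma r\<close>; undoing the normalisation gives the
  factor \<open>(2 * k) powr r\<close>.\<close>

lemma moment_signs:
  assumes G: "G \<subseteq> {..<m}" and q: "q > 0"
  shows "(\<Sum>\<epsilon>\<in>signs m. \<bar>\<Sum>j\<in>G. \<epsilon> j\<bar> powr q)
    \<le> 2 ^ m * (q * 2 powr (q / 2) * Gamma (q / 2) * real (card G) powr (q / 2))"
proof (cases "card G = 0")
  case True
  hence "G = {}" using G finite_subset[OF G] by simp
  thus ?thesis using q by simp
next
  case False
  define k where "k = real (card G)"
  have k: "k > 0" using False by (simp add: k_def)
  define r where "r = q / 2"
  have r: "r > 0" using q by (simp add: r_def)
  let ?s = "\<lambda>\<epsilon>. \<Sum>j\<in>G. \<epsilon> j :: real"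
  define w where "w = (\<lambda>\<epsilon>. (?s \<epsilon>)\<^sup>2 / (2 * k))"
  have w0: "w \<epsilon> \<ge> 0" for \<epsilon> using k by (simp add: w_def)
  have "((\<lambda>u. \<Sum>\<epsilon>\<in>signs m. r * u powr (r - 1) * (if u \<in> {0..w \<epsilon>} then 1 else 0))
          has_integral (\<Sum>\<epsilon>\<in>signs m. w \<epsilon> powr r)) {0..}"
    by (intro has_integral_sum has_integral_layer_cake r w0) auto
  moreover have "((\<lambda>u. 2 ^ m * (2 * r) * (u powr (r - 1) / exp u)) has_integral 2 ^ m * (2 * r) * Gamma r) {0..}"
    by (intro has_integral_mult_right Gamma_integral_real r)
  ultimately have main: "(\<Sum>\<epsilon>\<in>signs m. w \<epsilon> powr r) \<le> 2 ^ m * (2 * r) * Gamma r"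
  proof (rule has_integral_le)
    fix u :: real assume "u \<in> {0..}"
    hence u: "u \<ge> 0" by simp
    show "(\<Sum>\<epsilon>\<in>signs m. r * u powr (r - 1) * (if u \<in> {0..w \<epsilon>} then 1 else 0))
        \<le> 2 ^ m * (2 * r) * (u powr (r - 1) / exp u)"
    \<comment> \<open>At \<open>u = 0\<close> both sides vanish because
      \<open>0 powr (r - 1) = 0\<close>; the tail bound is thus applied only with
      \<open>t > 0\<close>.\<close>
    proof (cases "u = 0")
      case True
      thus ?thesis by simp
    next
      case False
      \<comment> \<open>The threshold for which \<open>u \<le> w\<close> says exactly that the sign
        sum has absolute value at least \<open>t\<close>.\<close>
      define t where "t = sqrt (2 * k * u)"
      have t: "t > 0" "t\<^sup>2 / (2 * k) = u" using False u k by (auto simp: t_def)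
      have "(u \<in> {0..w \<epsilon>}) = (t \<le> \<bar>?s \<epsilon>\<bar>)" for \<epsilon>
      proof -
        have "(u \<le> w \<epsilon>) = (t\<^sup>2 \<le> (?s \<epsilon>)\<^sup>2)"
          using t k by (simp add: w_def field_simps)
        also have "\<dots> = (t \<le> \<bar>?s \<epsilon>\<bar>)"
          using t abs_le_square_iff[of t "?s \<epsilon>"] by simp
        finally show ?thesis using u by simp
      qed
      hence "(\<Sum>\<epsilon>\<in>signs m. r * u powr (r - 1) * (if u \<in> {0..w \<epsilon>} then 1 else 0))
          = r * u powr (r - 1) * real (card {\<epsilon>\<in>signs m. t \<le> \<bar>?s \<epsilon>\<bar>})"
        by (simp add: sum.If_cases flip: sum_distrib_left Collect_conj_eq)
           (simp add: Int_def)
      also have "\<dots> \<le> r * u powr (r - 1) * (2 ^ m * (2 * exp (- u)))"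
        using tail_signs[OF G, of t] t k r
        by (intro mult_left_mono) (auto simp: k_def)
      finally show ?thesis by (simp add: exp_minus field_simps)
    qed
  qed
  have "\<bar>?s \<epsilon>\<bar> powr q = (2 * k) powr r * w \<epsilon> powr r" for \<epsilon>
  proof -
    have "\<bar>?s \<epsilon>\<bar> powr q = (\<bar>?s \<epsilon>\<bar> powr 2) powr r"
      by (simp only: powr_powr r_def) simp
    also have "\<dots> = ((?s \<epsilon>)\<^sup>2) powr r" by simp
    also have "(?s \<epsilon>)\<^sup>2 = 2 * k * w \<epsilon>" using k by (simp add: w_def)
    finally show ?thesis using k w0 by (simp add: powr_mult)
  qed
  hence "(\<Sum>\<epsilon>\<in>signs m. \<bar>?s \<epsilon>\<bar> powr q) = (2 * k) powr r * (\<Sum>\<epsilon>\<in>signs m. w \<epsilon> powr r)"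
    by (simp add: sum_distrib_left)
  also have "\<dots> \<le> (2 * k) powr r * (2 ^ m * (2 * r) * Gamma r)"
    by (intro mult_left_mono main) auto
  also have "\<dots> = 2 ^ m * (q * 2 powr (q / 2) * Gamma (q / 2) * k powr (q / 2))"
    using k by (simp add: r_def powr_mult)
  finally show ?thesis by (simp add: k_def)
qed

section \<open>Symmetric multilinear forms on sequence spaces\<close>

lemma ereal_ge_1_cases:
  assumes "1 \<le> (p::ereal)"
  obtains (real) q where "p = ereal q" "q \<ge> 1" | (inf) "p = \<infinity>"
  using assms by (cases p) auto

lemma in_lp_lincomb:
  assumes p: "1 \<le> p" and x: "in_lp p x" and y: "in_lp p y"
  shows "in_lp p (\<lambda>t. a * x t + b * y t)"
  using p
proof (cases rule: ereal_ge_1_cases)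
  case (real q)
  have sx: "summable (\<lambda>t. \<bar>x t\<bar> powr q)" and sy: "summable (\<lambda>t. \<bar>y t\<bar> powr q)"
    using x y real by (auto simp: in_lp_def)
  have "summable (\<lambda>t. (2 * \<bar>a\<bar>) powr q * \<bar>x t\<bar> powr q + (2 * \<bar>b\<bar>) powr q * \<bar>y t\<bar> powr q)"
    by (intro summable_add summable_mult sx sy)
  hence "summable (\<lambda>t. \<bar>a * x t + b * y t\<bar> powr q)"
  proof (rule summable_comparison_test'[where N = 0])
    fix t
    let ?u = "\<bar>a\<bar> * \<bar>x t\<bar>" and ?v = "\<bar>b\<bar> * \<bar>y t\<bar>"
    have "\<bar>a * x t + b * y t\<bar> \<le> ?u + ?v"
      by (metis abs_mult abs_triangle_ineq)
    \<comment> \<open>A sum is at most twice its larger term, and the power of a maximum is one of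
      the two powers. The lost constants do not affect summability.\<close>
    also have "\<dots> \<le> max (2 * ?u) (2 * ?v)" by linarith
    finally have "\<bar>a * x t + b * y t\<bar> powr q \<le> max (2 * ?u) (2 * ?v) powr q"
      using real by (intro powr_mono2) auto
    also have "\<dots> \<le> (2 * ?u) powr q + (2 * ?v) powr q"
      by (auto simp: max_def)
    also have "\<dots> = (2 * \<bar>a\<bar>) powr q * \<bar>x t\<bar> powr q + (2 * \<bar>b\<bar>) powr q * \<bar>y t\<bar> powr q"
      by (simp add: powr_mult)
    finally show "norm (\<bar>a * x t + b * y t\<bar> powr q)
       \<le> (2 * \<bar>a\<bar>) powr q * \<bar>x t\<bar> powr q + (2 * \<bar>b\<bar>) powr q * \<bar>y t\<bar> powr q"
      by simp
  qed
  thus ?thesis using real by (simp add: in_lp_def)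
next
  case inf
  obtain B C where B: "\<And>t. \<bar>x t\<bar> \<le> B" and C: "\<And>t. \<bar>y t\<bar> \<le> C"
    using x y inf by (auto simp: in_lp_def bounded_iff)
  have "\<bar>a * x t + b * y t\<bar> \<le> \<bar>a\<bar> * B + \<bar>b\<bar> * C" for t
  proof -
    have "\<bar>a * x t + b * y t\<bar> \<le> \<bar>a\<bar> * \<bar>x t\<bar> + \<bar>b\<bar> * \<bar>y t\<bar>"
      by (metis abs_mult abs_triangle_ineq)
    also have "\<dots> \<le> \<bar>a\<bar> * B + \<bar>b\<bar> * C"
      by (intro add_mono mult_left_mono B C) auto
    finally show ?thesis .
  qed
  thus ?thesis using inf by (auto simp: in_lp_def bounded_iff)
qed

lemma in_lp_zero: "in_lp p (\<lambda>t. 0)"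
  by (auto simp: in_lp_def)

lemma in_lp_scale: "1 \<le> p \<Longrightarrow> in_lp p x \<Longrightarrow> in_lp p (\<lambda>t. a * x t)"
  using in_lp_lincomb[of p x x a 0] by simp

lemma in_lp_sum:
  assumes "1 \<le> p" "finite A" "\<And>i. i \<in> A \<Longrightarrow> in_lp p (x i)"
  shows "in_lp p (\<lambda>t. \<Sum>i\<in>A. c i * x i t)"
  using assms(2,3)
proof (induction A rule: finite_induct)
  case empty
  thus ?case by (simp add: in_lp_zero)
next
  case (insert i A)
  hence "in_lp p (\<lambda>t. c i * x i t + 1 * (\<Sum>i\<in>A. c i * x i t))"
    by (intro in_lp_lincomb[OF assms(1)]) auto
  thus ?case using insert by simp
qed

lemma lp_norm_nonneg:
  assumes "1 \<le> p" "in_lp p x"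
  shows "lp_norm p x \<ge> 0"
  using assms(1)
proof (cases rule: ereal_ge_1_cases)
  case inf
  have "bdd_above (range (\<lambda>i. \<bar>x i\<bar>))"
    using assms inf by (auto simp: in_lp_def bounded_iff bdd_above_def)
  thus ?thesis using inf cSUP_upper[of 0 UNIV "\<lambda>i. \<bar>x i\<bar>"] by (auto simp: lp_norm_def intro: order_trans[rotated])
qed (simp add: lp_norm_def)

lemma coord_le_lp_norm:
  assumes "1 \<le> p" "in_lp p x"
  shows "\<bar>x t\<bar> \<le> lp_norm p x"
  using assms(1)
proof (cases rule: ereal_ge_1_cases)
  case inf
  have "bdd_above (range (\<lambda>i. \<bar>x i\<bar>))"
    using assms inf by (auto simp: in_lp_def bounded_iff bdd_above_def)
  thus ?thesis using inf by (auto simp: lp_norm_def intro: cSUP_upper)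
next
  case (real q)
  have "\<bar>x t\<bar> powr q \<le> (\<Sum>i. \<bar>x i\<bar> powr q)"
    using sum_le_suminf[of "\<lambda>i. \<bar>x i\<bar> powr q" "{t}"] assms real by (simp add: in_lp_def)
  hence "(\<bar>x t\<bar> powr q) powr (1/q) \<le> (\<Sum>i. \<bar>x i\<bar> powr q) powr (1/q)"
    using real by (intro powr_mono2) auto
  thus ?thesis using real by (simp add: lp_norm_def powr_powr)
qed

lemma lp_norm_scale:
  assumes p: "1 \<le> p" and x: "in_lp p x" and a: "a \<ge> 0"
  shows "lp_norm p (\<lambda>t. a * x t) = a * lp_norm p x"
  using p
proof (cases rule: ereal_ge_1_cases)
  case (real q)
  have "summable (\<lambda>t. \<bar>x t\<bar> powr q)" using x real by (simp add: in_lp_def)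
  hence "(\<Sum>t. \<bar>a * x t\<bar> powr q) = a powr q * (\<Sum>t. \<bar>x t\<bar> powr q)"
    using a by (simp add: abs_mult powr_mult suminf_mult)
  moreover have "(\<Sum>t. \<bar>x t\<bar> powr q) \<ge> 0"
    using x real by (intro suminf_nonneg) (auto simp: in_lp_def)
  ultimately show ?thesis using real a
    by (simp add: lp_norm_def powr_mult powr_powr)
next
  case inf
  have bdd: "bdd_above (range (\<lambda>i. \<bar>x i\<bar>))"
    using x inf by (auto simp: in_lp_def bounded_iff bdd_above_def)
  have "continuous (at_left (SUP i. \<bar>x i\<bar>)) (\<lambda>u. a * u)"
    by (intro continuous_intros)
  hence "a * (SUP i. \<bar>x i\<bar>) = (SUP i. a * \<bar>x i\<bar>)"
    using continuous_at_Sup_mono[of "\<lambda>u. a * u" "range (\<lambda>i. \<bar>x i\<bar>)"] a bdd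
    by (auto simp: mono_def mult_left_mono image_image)
  thus ?thesis using inf a by (simp add: lp_norm_def abs_mult)
qed

section \<open>Multilinear calculus on lists of arguments\<close>

text \<open>The definition phrases linearity through list updates; splitting the list around the
  distinguished argument instead suits inductions that treat one argument after the other.\<close>

lemma sym_mlin_form_linear:
  assumes "sym_mlin_form p m L" "length xs + length ys + 1 = m"
    "\<forall>z\<in>set xs. in_lp p z" "\<forall>z\<in>set ys. in_lp p z" "in_lp p x" "in_lp p y"
  shows "L (xs @ (\<lambda>t. a * x t + b * y t) # ys) = a * L (xs @ x # ys) + b * L (xs @ y # ys)"
proof -
  have "L ((xs @ x # ys)[length xs := (\<lambda>t. a * x t + b * y t)])
      = a * L ((xs @ x # ys)[length xs := x]) + b * L ((xs @ x # ys)[length xs := y])"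
  proof -
    have "\<forall>i<m. \<forall>zs x y (a::real) (b::real).
        length zs = m \<and> (\<forall>z\<in>set zs. in_lp p z) \<and> in_lp p x \<and> in_lp p y \<longrightarrow>
        L (zs[i := (\<lambda>t. a * x t + b * y t)]) = a * L (zs[i := x]) + b * L (zs[i := y])"
      using assms(1) unfolding sym_mlin_form_def by (rule conjunct1)
    moreover have "length xs < m" "length (xs @ x # ys) = m" "\<forall>z\<in>set (xs @ x # ys). in_lp p z"
      using assms by auto
    ultimately show ?thesis using assms(5,6) by blast
  qed
  thus ?thesis by (simp only: list_update_length)
qed

lemma sym_mlin_form_scale:
  assumes "sym_mlin_form p m L" "length xs + length ys + 1 = m"
    "\<forall>z\<in>set xs. in_lp p z" "\<forall>z\<in>set ys. in_lp p z" "in_lp p x"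
  shows "L (xs @ (\<lambda>t. a * x t) # ys) = a * L (xs @ x # ys)"
  using sym_mlin_form_linear[OF assms(1-5) assms(5), of a 0] by simp

lemma sym_mlin_form_sum:
  assumes p: "1 \<le> p" and L: "sym_mlin_form p m L" and len: "length xs + length ys + 1 = m"
    and xs: "\<forall>z\<in>set xs. in_lp p z" and ys: "\<forall>z\<in>set ys. in_lp p z"
    and A: "finite A" "\<And>i. i \<in> A \<Longrightarrow> in_lp p (x i)"
  shows "L (xs @ (\<lambda>t. \<Sum>i\<in>A. c i * x i t) # ys) = (\<Sum>i\<in>A. c i * L (xs @ x i # ys))"
  using A
proof (induction A rule: finite_induct)
  case empty
  show ?case using sym_mlin_form_scale[OF L len xs ys in_lp_zero, of 0] by simp
next
  case (insert i A)
  have "L (xs @ (\<lambda>t. c i * x i t + 1 * (\<Sum>i\<in>A. c i * x i t)) # ys)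
     = c i * L (xs @ x i # ys) + 1 * L (xs @ (\<lambda>t. \<Sum>i\<in>A. c i * x i t) # ys)"
    using insert by (intro sym_mlin_form_linear[OF L len xs ys] in_lp_sum p) auto
  thus ?case using insert by simp
qed

text \<open>Homogeneity in many arguments at once. The prefix \<open>xs\<close> collects the
  arguments already freed of their scalars, which is what the induction needs. Applications are the
  normalisation of a diagonal argument and the rescaling of the vectors \<open>x i\<close> by
  different factors.\<close>

lemma sym_mlin_form_map_scale:
  assumes p: "1 \<le> p" and L: "sym_mlin_form p m L"
    and "length xs + length ws = m" "\<forall>z\<in>set xs. in_lp p z" "\<And>w. w \<in> set ws \<Longrightarrow> in_lp p (x w)"
  shows "L (xs @ map (\<lambda>w t. c w * x w t) ws) = prod_list (map c ws) * L (xs @ map x ws)"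
  using assms(3-5)
proof (induction ws arbitrary: xs)
  case Nil
  thus ?case by simp
next
  case (Cons w ws)
  have "L (xs @ map (\<lambda>w t. c w * x w t) (w # ws))
      = c w * L (xs @ x w # map (\<lambda>w t. c w * x w t) ws)"
    using Cons.prems
    by simp (intro sym_mlin_form_scale[OF L], auto intro!: in_lp_scale p)
  also have "L (xs @ x w # map (\<lambda>w t. c w * x w t) ws) = prod_list (map c ws) * L ((xs @ [x w]) @ map x ws)"
    using Cons.prems Cons.IH[of "xs @ [x w]"] by auto
  finally show ?case by simp
qed

section \<open>Polarization\<close>

text \<open>The index set of the multinomial expansion: the letter at a position records which
  summand was chosen for that argument.\<close>

definition words :: "'a set \<Rightarrow> nat \<Rightarrow> 'a list set" where
  "words A j = {ws. set ws \<subseteq> A \<and> length ws = j}"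

lemma finite_words: "finite A \<Longrightarrow> finite (words A j)"
  unfolding words_def by (rule finite_lists_length_eq)

lemma sum_words_Suc:
  assumes "finite A"
  shows "(\<Sum>ws\<in>words A (Suc j). f ws) = (\<Sum>w\<in>A. \<Sum>ws\<in>words A j. f (w # ws))"
proof -
  have "words A (Suc j) = (\<lambda>(w, ws). w # ws) ` (A \<times> words A j)"
    by (auto simp: words_def image_iff length_Suc_conv)
  moreover have "inj_on (\<lambda>(w, ws). w # ws) (A \<times> words A j)"
    by (auto simp: inj_on_def)
  ultimately show ?thesis
    by (simp add: sum.reindex sum.cartesian_product case_prod_unfold)
qed

text \<open>Each of the \<open>j\<close> equal arguments is expanded by linearity in turn, and the
  chosen vectors join the prefix.\<close>

lemma sym_mlin_form_expand:
  assumes p: "1 \<le> p" and L: "sym_mlin_form p m L" and A: "finite A" "\<And>i. i \<in> A \<Longrightarrow> in_lp p (x i)"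
    and "length xs + j = m" "\<forall>z\<in>set xs. in_lp p z"
  shows "L (xs @ replicate j (\<lambda>t. \<Sum>i\<in>A. c i * x i t))
       = (\<Sum>ws\<in>words A j. prod_list (map c ws) * L (xs @ map x ws))"
  using assms(5-6)
proof (induction j arbitrary: xs)
  case 0
  have "words A 0 = {[]}" by (auto simp: words_def)
  thus ?case by simp
next
  case (Suc j)
  let ?v = "\<lambda>t. \<Sum>i\<in>A. c i * x i t"
  have v: "in_lp p ?v" by (intro in_lp_sum p A)
  have "L (xs @ replicate (Suc j) ?v) = (\<Sum>i\<in>A. c i * L (xs @ x i # replicate j ?v))"
    unfolding replicate_Suc using Suc.prems v
    by (intro sym_mlin_form_sum[OF p L] A) auto
  also have "\<dots> = (\<Sum>i\<in>A. c i * (\<Sum>ws\<in>words A j. prod_list (map c ws) * L ((xs @ [x i]) @ map x ws)))"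
  proof (rule sum.cong[OF refl])
    fix i assume "i \<in> A"
    thus "c i * L (xs @ x i # replicate j ?v) = c i * (\<Sum>ws\<in>words A j. prod_list (map c ws) * L ((xs @ [x i]) @ map x ws))"
      using Suc.IH[of "xs @ [x i]"] Suc.prems A by auto
  qed
  finally show ?case using A(1)
    by (simp add: sum_words_Suc sum_distrib_left mult.assoc)
qed

lemma prod_list_eq_prod_count:
  assumes "finite A" "set ws \<subseteq> A"
  shows "prod_list (map c ws) = (\<Prod>i\<in>A. c i ^ count_list ws i :: 'b::comm_monoid_mult)"
  using assms(2)
proof (induction ws)
  case (Cons w ws)
  have "(\<Prod>i\<in>A. c i ^ count_list (w # ws) i) = (\<Prod>i\<in>A. (if i = w then c i else 1) * c i ^ count_list ws i)"
    by (rule prod.cong) auto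
  also have "\<dots> = c w * (\<Prod>i\<in>A. c i ^ count_list ws i)"
    using assms(1) Cons.prems by (simp add: prod.distrib)
  finally show ?case using Cons by simp
qed simp

text \<open>The sign with index \<open>j\<close> occurs to the power one plus the number of
  occurrences of \<open>j\<close> in the word. An odd power averages to zero, while in a permutation
  every exponent is 2.\<close>

lemma sum_signs_word:
  assumes "ws \<in> words {..<m} m"
  shows "(\<Sum>\<epsilon>\<in>signs m. (\<Prod>j<m. \<epsilon> j) * prod_list (map \<epsilon> ws))
    = (if ws \<in> permutations_of_set {..<m} then 2 ^ m else 0)"
proof -
  have ws: "set ws \<subseteq> {..<m}" "length ws = m" using assms by (auto simp: words_def)
  have "(\<Sum>\<epsilon>\<in>signs m. (\<Prod>j<m. \<epsilon> j) * prod_list (map \<epsilon> ws))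
     = (\<Sum>\<epsilon>\<in>signs m. \<Prod>j<m. \<epsilon> j ^ Suc (count_list ws j))"
    using ws by (subst prod_list_eq_prod_count[of "{..<m}"]) (auto simp: prod.distrib)
  also have "\<dots> = (\<Prod>j<m. (-1) ^ Suc (count_list ws j) + 1 :: real)"
    by (subst sum_prod_signs) simp
  also have "\<dots> = (if ws \<in> permutations_of_set {..<m} then 2 ^ m else 0)"
  proof (cases "ws \<in> permutations_of_set {..<m}")
    case True
    hence "count_list ws j = 1" if "j < m" for j
      using that by (auto simp: permutations_of_set_def distinct_count_atmost_1 simp flip: count_mset)
    thus ?thesis using True by simp
  next
    case False
    \<comment> \<open>A word of length \<open>m\<close> that uses all \<open>m\<close> letters has
      no repetition, so a word that is not a permutation misses a letter; the corresponding sign has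
      exponent 1.\<close>
    hence "set ws \<noteq> {..<m}"
      using ws by (auto simp: permutations_of_set_def intro: card_distinct)
    then obtain j where "j < m" "j \<notin> set ws" using ws by auto
    hence "(-1) ^ Suc (count_list ws j) + 1 = (0::real)"
      by (simp add: count_list_0_iff)
    thus ?thesis using False \<open>j < m\<close> by (auto intro!: prod_zero)
  qed
  finally show ?thesis .
qed

text \<open>After expansion and averaging only the words that are permutations survive. There are
  \<open>fact m\<close> of them, and by symmetry each contributes \<open>L ys\<close>.\<close>

lemma polarization:
  assumes p: "1 \<le> p" and L: "sym_mlin_form p m L" and y: "length ys = m" "\<forall>z\<in>set ys. in_lp p z"
  shows "(\<Sum>\<epsilon>\<in>signs m. (\<Prod>j<m. \<epsilon> j) * L (replicate m (\<lambda>t. \<Sum>j<m. \<epsilon> j * (ys ! j) t)))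
       = 2 ^ m * fact m * L ys"
proof -
  have "(\<Sum>\<epsilon>\<in>signs m. (\<Prod>j<m. \<epsilon> j) * L (replicate m (\<lambda>t. \<Sum>j<m. \<epsilon> j * (ys ! j) t)))
     = (\<Sum>\<epsilon>\<in>signs m. (\<Prod>j<m. \<epsilon> j) * (\<Sum>ws\<in>words {..<m} m. prod_list (map \<epsilon> ws) * L (map ((!) ys) ws)))"
  proof (rule sum.cong[OF refl])
    fix \<epsilon>
    show "(\<Prod>j<m. \<epsilon> j) * L (replicate m (\<lambda>t. \<Sum>j<m. \<epsilon> j * (ys ! j) t))
        = (\<Prod>j<m. \<epsilon> j) * (\<Sum>ws\<in>words {..<m} m. prod_list (map \<epsilon> ws) * L (map ((!) ys) ws))"
      using sym_mlin_form_expand[OF p L, of "{..<m}" "(!) ys" "[]" m \<epsilon>] y by auto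
  qed
  also have "\<dots> = (\<Sum>ws\<in>words {..<m} m. (\<Sum>\<epsilon>\<in>signs m. (\<Prod>j<m. \<epsilon> j) * prod_list (map \<epsilon> ws)) * L (map ((!) ys) ws))"
    unfolding sum_distrib_left sum_distrib_right
    by (subst sum.swap) (simp add: mult_ac)
  also have "\<dots> = (\<Sum>ws\<in>words {..<m} m. if ws \<in> permutations_of_set {..<m} then 2 ^ m * L ys else 0)"
  proof (rule sum.cong[OF refl])
    fix ws assume ws: "ws \<in> words {..<m} m"
    have "L (map ((!) ys) ws) = L ys" if "ws \<in> permutations_of_set {..<m}"
    proof -
      have "mset ws = mset [0..<m]"
        using that by (metis atLeast_upt distinct_upt permutations_of_setD set_eq_iff_mset_eq_distinct)
      hence "mset (map ((!) ys) ws) = mset (map ((!) ys) [0..<m])" by simp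
      also have "map ((!) ys) [0..<m] = ys" using y map_nth by blast
      finally show ?thesis using L y unfolding sym_mlin_form_def by blast
    qed
    thus "(\<Sum>\<epsilon>\<in>signs m. (\<Prod>j<m. \<epsilon> j) * prod_list (map \<epsilon> ws)) * L (map ((!) ys) ws)
        = (if ws \<in> permutations_of_set {..<m} then 2 ^ m * L ys else 0)"
      by (simp add: sum_signs_word[OF ws])
  qed
  also have "\<dots> = (\<Sum>ws\<in>permutations_of_set {..<m}. 2 ^ m * L ys)"
  proof (subst sum.inter_restrict[symmetric])
    show "finite (words {..<m} m)" by (simp add: finite_words)
    have "permutations_of_set {..<m} \<subseteq> words {..<m} m"
      using distinct_card by (fastforce simp: words_def permutations_of_set_def)
    hence "words {..<m} m \<inter> permutations_of_set {..<m} = permutations_of_set {..<m}"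
      by blast
    thus "(\<Sum>ws\<in>words {..<m} m \<inter> permutations_of_set {..<m}. 2 ^ m * L ys) = (\<Sum>ws\<in>permutations_of_set {..<m}. 2 ^ m * L ys)"
      by simp
  qed
  also have "\<dots> = 2 ^ m * fact m * L ys"
    by (simp add: card_permutations_of_set)
  finally show ?thesis .
qed

section \<open>The norm of the diagonal polynomial\<close>

text \<open>A real supremum carries information only for bounded sets; here continuity of the form
  supplies the bound. The absolute value is taken because the definition does not fix the sign of
  \<open>C\<close>.\<close>

lemma bdd_poly_norm:
  assumes p: "1 \<le> p" and L: "sym_mlin_form p m L"
  shows "bdd_above {\<bar>L (replicate m x)\<bar> | x. in_lp p x \<and> lp_norm p x \<le> 1}"
proof -
  obtain C where C: "\<And>xs. length xs = m \<Longrightarrow> (\<forall>z\<in>set xs. in_lp p z) \<Longrightarrow>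
        \<bar>L xs\<bar> \<le> C * prod_list (map (lp_norm p) xs)"
    using L unfolding sym_mlin_form_def by blast
  have "\<bar>L (replicate m x)\<bar> \<le> \<bar>C\<bar>" if "in_lp p x" "lp_norm p x \<le> 1" for x
  proof -
    have "\<bar>L (replicate m x)\<bar> \<le> C * lp_norm p x ^ m"
      using C[of "replicate m x"] that by (simp add: prod_list_replicate)
    also have "\<dots> \<le> \<bar>C\<bar> * 1"
      using that lp_norm_nonneg[OF p that(1)] by (intro mult_mono power_le_one) auto
    finally show ?thesis by simp
  qed
  thus ?thesis by (intro bdd_aboveI[of _ "\<bar>C\<bar>"]) auto
qed

lemma poly_norm_nonneg:
  assumes p: "1 \<le> p" and L: "sym_mlin_form p m L"
  shows "poly_norm p m L \<ge> 0"
proof -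
  have "lp_norm p (\<lambda>t. 0) \<le> 1"
    using lp_norm_scale[OF p in_lp_zero, of 0] by simp
  hence "\<bar>L (replicate m (\<lambda>t. 0))\<bar> \<le> poly_norm p m L"
    unfolding poly_norm_def
    by (intro cSup_upper bdd_poly_norm[OF p L]) (auto intro!: exI[of _ "\<lambda>t. 0"] in_lp_zero)
  thus ?thesis by linarith
qed

lemma diag_le_poly_norm:
  assumes p: "1 \<le> p" and L: "sym_mlin_form p m L" and m: "m > 0"
    and x: "in_lp p x" "lp_norm p x \<le> M" and M: "M \<ge> 0"
  shows "\<bar>L (replicate m x)\<bar> \<le> M ^ m * poly_norm p m L"
proof (cases "M = 0")
  case False
  hence M: "M > 0" using M by simp
  define y where "y = (\<lambda>t. (1/M) * x t)"
  have y: "in_lp p y" unfolding y_def by (rule in_lp_scale[OF p x(1)])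
  have "lp_norm p y = (1/M) * lp_norm p x"
    unfolding y_def by (rule lp_norm_scale[OF p x(1)]) (use M in auto)
  hence "lp_norm p y \<le> 1" using x M by simp
  hence "\<bar>L (replicate m y)\<bar> \<le> poly_norm p m L"
    unfolding poly_norm_def
    by (intro cSup_upper bdd_poly_norm[OF p L]) (use y in auto)
  moreover have "x = (\<lambda>t. M * y t)" using M by (simp add: y_def)
  hence "L (replicate m x) = M ^ m * L (replicate m y)"
    \<comment> \<open>All arguments are equal, so the word is \<open>m\<close> copies of the dummy
      letter \<open>()\<close>.\<close>
    using sym_mlin_form_map_scale[OF p L, of "[]" "replicate m ()" "\<lambda>_. y" "\<lambda>_. M"] y
    by (simp add: prod_list_replicate)
  ultimately show ?thesis using M by (simp add: abs_mult)
next
  \<comment> \<open>Normalising by \<open>M\<close> is impossible here. The norm of \<open>x\<close>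
    is zero, and the continuity estimate forces the value to vanish since
    \<open>m > 0\<close>.\<close>
  case True
  obtain C where C: "\<And>xs. length xs = m \<Longrightarrow> (\<forall>z\<in>set xs. in_lp p z) \<Longrightarrow>
        \<bar>L xs\<bar> \<le> C * prod_list (map (lp_norm p) xs)"
    using L unfolding sym_mlin_form_def by blast
  have "lp_norm p x = 0" using x(2) True lp_norm_nonneg[OF p x(1)] by linarith
  hence "\<bar>L (replicate m x)\<bar> \<le> 0"
    using C[of "replicate m x"] x(1) m by (simp add: prod_list_replicate zero_power)
  thus ?thesis using m True by (simp add: zero_power)
qed

text \<open>The triangle inequality in the polarization formula, all products of signs having
  absolute value 1. The majorant \<open>M\<close> of the norm stays free, because the upper bounds
  estimate it differently.\<close>

lemma polarization_bound:
  assumes p: "1 \<le> p" and L: "sym_mlin_form p m L" and m: "m > 0"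
    and y: "length ys = m" "\<forall>z\<in>set ys. in_lp p z"
    and M: "\<And>\<epsilon>. \<epsilon> \<in> signs m \<Longrightarrow> lp_norm p (\<lambda>t. \<Sum>j<m. \<epsilon> j * (ys ! j) t) \<le> M \<epsilon>"
      "\<And>\<epsilon>. \<epsilon> \<in> signs m \<Longrightarrow> M \<epsilon> \<ge> 0"
  shows "\<bar>L ys\<bar> \<le> (\<Sum>\<epsilon>\<in>signs m. M \<epsilon> ^ m) / (2 ^ m * fact m) * poly_norm p m L"
proof -
  have "2 ^ m * fact m * \<bar>L ys\<bar>
     = \<bar>\<Sum>\<epsilon>\<in>signs m. (\<Prod>j<m. \<epsilon> j) * L (replicate m (\<lambda>t. \<Sum>j<m. \<epsilon> j * (ys ! j) t))\<bar>"
    unfolding polarization[OF p L y] by (simp add: abs_mult)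
  also have "\<dots> \<le> (\<Sum>\<epsilon>\<in>signs m. M \<epsilon> ^ m * poly_norm p m L)"
  proof (rule order_trans[OF sum_abs], rule sum_mono)
    fix \<epsilon> assume \<epsilon>: "\<epsilon> \<in> signs m"
    have "\<bar>\<Prod>j<m. \<epsilon> j\<bar> = (\<Prod>j<m. \<bar>\<epsilon> j\<bar>)" by (rule abs_prod)
    also have "\<dots> = (\<Prod>j<m. 1)"
      by (rule prod.cong) (use signs_cases[OF \<epsilon>] in fastforce)+
    finally have "\<bar>\<Prod>j<m. \<epsilon> j\<bar> = 1" by simp
    moreover have "in_lp p (\<lambda>t. \<Sum>j<m. \<epsilon> j * (ys ! j) t)"
      using y by (intro in_lp_sum p) auto
    ultimately show "\<bar>(\<Prod>j<m. \<epsilon> j) * L (replicate m (\<lambda>t. \<Sum>j<m. \<epsilon> j * (ys ! j) t))\<bar> \<le> M \<epsilon> ^ m * poly_norm p m L"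
      using diag_le_poly_norm[OF p L m _ M(1)[OF \<epsilon>] M(2)[OF \<epsilon>]] by (simp add: abs_mult)
  qed
  finally show ?thesis
    by (simp add: field_simps flip: sum_distrib_right sum_distrib_left)
qed

section \<open>Upper bounds\<close>

text \<open>The word of indices behind \<open>rep_tuple\<close>: position \<open>j\<close> of the
  tuple holds the vector with index \<open>index_list n k ! j\<close>. Regrouping equal vectors then
  amounts to counting letters.\<close>

definition index_list :: "nat \<Rightarrow> (nat \<Rightarrow> nat) \<Rightarrow> nat list" where
  "index_list n k = concat (map (\<lambda>i. replicate (k i) i) [0..<n])"

lemma rep_tuple_eq_map: "rep_tuple n k x = map x (index_list n k)"
  by (simp add: rep_tuple_def index_list_def map_concat o_def)

lemma length_index_list: "length (index_list n k) = (\<Sum>i<n. k i)"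
  by (induction n) (auto simp: index_list_def)

lemma set_index_list: "set (index_list n k) = {i. i < n \<and> k i > 0}"
  by (auto simp: index_list_def)

lemma count_index_list: "count_list (index_list n k) i = (if i < n then k i else 0)"
proof -
  have "count_list (replicate a j) i = (if i = j then a else 0)" for a j
    by (induction a) auto
  thus ?thesis by (induction n) (auto simp: index_list_def less_Suc_eq)
qed

lemma card_index_class:
  "card {j. j < (\<Sum>i<n. k i) \<and> index_list n k ! j = i} = (if i < n then k i else 0)"
  using count_list_eq_length_filter[of "index_list n k" i]
  by (simp add: length_filter_conv_card length_index_list count_index_list eq_commute)

text \<open>The random coefficient that the vector with index \<open>i\<close> receives in the
  polarization formula, a sum of \<open>k i\<close> independent signs when
  \<open>i < n\<close>.\<close>

definition sign_sum :: "nat \<Rightarrow> (nat \<Rightarrow> nat) \<Rightarrow> (nat \<Rightarrow> real) \<Rightarrow> nat \<Rightarrow> real" where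
  "sign_sum n k \<epsilon> i = (\<Sum>j\<in>{j. j < (\<Sum>i<n. k i) \<and> index_list n k ! j = i}. \<epsilon> j)"

lemma sum_index_list:
  "(\<Sum>j<(\<Sum>i<n. k i). \<epsilon> j * (map y (index_list n k) ! j) t) = (\<Sum>i<n. sign_sum n k \<epsilon> i * y i t)"
proof -
  let ?m = "\<Sum>i<n. k i" and ?g = "index_list n k"
  have "(\<Sum>j<?m. \<epsilon> j * (map y ?g ! j) t) = (\<Sum>j<?m. \<epsilon> j * y (?g ! j) t)"
    by (rule sum.cong) (auto simp: length_index_list)
  also have "\<dots> = (\<Sum>i<n. \<Sum>j\<in>{j\<in>{..<?m}. ?g ! j = i}. \<epsilon> j * y (?g ! j) t)"
  proof (rule sum.group[symmetric])
    have "?g ! j < n" if "j < ?m" for j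
      using that set_index_list[of n k] length_index_list[of n k] nth_mem[of j ?g] by auto
    thus "(!) ?g ` {..<?m} \<subseteq> {..<n}" by auto
  qed auto
  also have "\<dots> = (\<Sum>i<n. sign_sum n k \<epsilon> i * y i t)"
    unfolding sign_sum_def sum_distrib_right by (intro sum.cong) auto
  finally show ?thesis .
qed

lemma abs_sign_sum_le:
  assumes "\<epsilon> \<in> signs (\<Sum>i<n. k i)" "i < n"
  shows "\<bar>sign_sum n k \<epsilon> i\<bar> \<le> real (k i)"
proof -
  have "\<bar>sign_sum n k \<epsilon> i\<bar> \<le> (\<Sum>j\<in>{j. j < (\<Sum>i<n. k i) \<and> index_list n k ! j = i}. \<bar>\<epsilon> j\<bar>)"
    unfolding sign_sum_def by (rule sum_abs)
  also have "\<dots> = (\<Sum>j\<in>{j. j < (\<Sum>i<n. k i) \<and> index_list n k ! j = i}. 1)"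
    by (rule sum.cong) (use signs_cases[OF assms(1)] in fastforce)+
  finally show ?thesis using card_index_class[of k n i] assms(2) by simp
qed

text \<open>A sum of signs is an integer. This gap between 0 and 1 serves to compare different
  powers in the case \<open>q \<ge> m\<close>.\<close>

lemma abs_sign_sum_zero_or_ge_1:
  assumes "\<epsilon> \<in> signs (\<Sum>i<n. k i)"
  shows "sign_sum n k \<epsilon> i = 0 \<or> \<bar>sign_sum n k \<epsilon> i\<bar> \<ge> 1"
proof -
  have "sign_sum n k \<epsilon> i \<in> \<int>"
    unfolding sign_sum_def by (rule Ints_sum) (use signs_cases[OF assms] in fastforce)
  thus ?thesis using Ints_nonzero_abs_ge1 by blast
qed

section \<open>Norms of combinations of disjointly supported vectors\<close>

lemma disjoint_at:
  fixes x :: "nat \<Rightarrow> nat \<Rightarrow> real"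
  assumes "\<forall>i<n. \<forall>j<n. i \<noteq> j \<longrightarrow> (\<forall>t. x i t = 0 \<or> x j t = 0)"
  obtains "\<And>i. i < n \<Longrightarrow> x i t = 0"
  | i0 where "i0 < n" "\<And>i. i < n \<Longrightarrow> i \<noteq> i0 \<Longrightarrow> x i t = 0"
  using assms by metis

lemma sum_single_nonzero:
  assumes "i0 < (n::nat)" "\<And>i. i < n \<Longrightarrow> i \<noteq> i0 \<Longrightarrow> f i = (0::real)"
  shows "(\<Sum>i<n. f i) = f i0"
proof -
  have "(\<Sum>i<n. f i) = (\<Sum>i\<in>{i0}. f i)"
    by (rule sum.mono_neutral_right) (use assms in auto)
  thus ?thesis by simp
qed

text \<open>At every coordinate at most one summand is nonzero, so the \<open>q\<close>-th power of
  the absolute value passes through the sum over \<open>i\<close>. Summing over coordinates replaces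
  each \<open>x i\<close> by its norm 1.\<close>

lemma lp_norm_disjoint_sum:
  fixes n :: nat
  assumes q: "q \<ge> 1" and x: "\<forall>i<n. in_lp (ereal q) (x i) \<and> lp_norm (ereal q) (x i) = 1"
    and d: "\<forall>i<n. \<forall>j<n. i \<noteq> j \<longrightarrow> (\<forall>t. x i t = 0 \<or> x j t = 0)"
  shows "lp_norm (ereal q) (\<lambda>t. \<Sum>i<n. s i * x i t) = (\<Sum>i<n. \<bar>s i\<bar> powr q) powr (1 / q)"
proof -
  have sm: "summable (\<lambda>t. \<bar>x i t\<bar> powr q)" if "i < n" for i
    using x that by (auto simp: in_lp_def)
  have one: "(\<Sum>t. \<bar>x i t\<bar> powr q) = 1" if "i < n" for i
  proof -
    have "(\<Sum>t. \<bar>x i t\<bar> powr q) powr (1 / q) = 1"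
      using x that by (auto simp: lp_norm_def)
    hence "((\<Sum>t. \<bar>x i t\<bar> powr q) powr (1 / q)) powr q = 1" by simp
    thus ?thesis using q suminf_nonneg[OF sm[OF that]] by (simp add: powr_powr)
  qed
  have "\<bar>\<Sum>i<n. s i * x i t\<bar> powr q = (\<Sum>i<n. \<bar>s i\<bar> powr q * \<bar>x i t\<bar> powr q)" for t
  proof (rule disjoint_at[OF d, of t])
    assume "\<And>i. i < n \<Longrightarrow> x i t = 0"
    thus ?thesis using q by simp
  next
    fix i0 assume i0: "i0 < n" "\<And>i. i < n \<Longrightarrow> i \<noteq> i0 \<Longrightarrow> x i t = 0"
    have "(\<Sum>i<n. s i * x i t) = s i0 * x i0 t"
      by (rule sum_single_nonzero) (use i0 in auto)
    moreover have "(\<Sum>i<n. \<bar>s i\<bar> powr q * \<bar>x i t\<bar> powr q) = \<bar>s i0\<bar> powr q * \<bar>x i0 t\<bar> powr q"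
      by (rule sum_single_nonzero) (use i0 in auto)
    ultimately show ?thesis by (simp add: abs_mult powr_mult)
  qed
  hence "(\<Sum>t. \<bar>\<Sum>i<n. s i * x i t\<bar> powr q) = (\<Sum>t. \<Sum>i<n. \<bar>s i\<bar> powr q * \<bar>x i t\<bar> powr q)"
    by simp
  also have "\<dots> = (\<Sum>i<n. \<Sum>t. \<bar>s i\<bar> powr q * \<bar>x i t\<bar> powr q)"
    by (rule suminf_sum) (auto intro: summable_mult sm)
  also have "\<dots> = (\<Sum>i<n. \<bar>s i\<bar> powr q)"
    by (rule sum.cong) (auto simp: suminf_mult sm one)
  finally show ?thesis by (simp add: lp_norm_def)
qed

lemma linf_norm_disjoint_sum:
  fixes n :: nat
  assumes x: "\<forall>i<n. in_lp \<infinity> (x i) \<and> lp_norm \<infinity> (x i) = 1"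
    and d: "\<forall>i<n. \<forall>j<n. i \<noteq> j \<longrightarrow> (\<forall>t. x i t = 0 \<or> x j t = 0)"
    and s: "\<And>i. i < n \<Longrightarrow> \<bar>s i\<bar> \<le> 1"
  shows "lp_norm \<infinity> (\<lambda>t. \<Sum>i<n. s i * x i t) \<le> 1"
proof -
  have "\<bar>\<Sum>i<n. s i * x i t\<bar> \<le> 1" for t
  proof (rule disjoint_at[OF d, of t])
    assume "\<And>i. i < n \<Longrightarrow> x i t = 0"
    thus ?thesis by simp
  next
    fix i0 assume i0: "i0 < n" "\<And>i. i < n \<Longrightarrow> i \<noteq> i0 \<Longrightarrow> x i t = 0"
    have "(\<Sum>i<n. s i * x i t) = s i0 * x i0 t"
      by (rule sum_single_nonzero) (use i0 in auto)
    moreover have "\<bar>s i0\<bar> * \<bar>x i0 t\<bar> \<le> 1 * 1"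
      using s[OF i0(1)] coord_le_lp_norm[of \<infinity> "x i0" t] x i0(1)
      by (intro mult_mono) auto
    ultimately show ?thesis by (simp add: abs_mult)
  qed
  thus ?thesis by (auto simp: lp_norm_def intro: cSUP_least)
qed

section \<open>Admissible constants and the first upper bound\<close>

definition admissible :: "ereal \<Rightarrow> nat \<Rightarrow> (nat \<Rightarrow> nat) \<Rightarrow> real \<Rightarrow> bool" where
  "admissible p n k c \<longleftrightarrow> (\<forall>L x. sym_mlin_form p (\<Sum>i<n. k i) L \<and>
        (\<forall>i<n. in_lp p (x i) \<and> lp_norm p (x i) = 1) \<and>
        (\<forall>i<n. \<forall>j<n. i \<noteq> j \<longrightarrow> (\<forall>t. x i t = 0 \<or> x j t = 0)) \<longrightarrow>
        \<bar>L (rep_tuple n k x)\<bar> \<le> c * poly_norm p (\<Sum>i<n. k i) L)"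

lemma cp_eq_Inf_admissible: "cp p n k = Inf {c. admissible p n k c}"
  by (simp add: cp_def admissible_def)

text \<open>Polarization after regrouping, with \<open>B\<close> a bound for the mean of
  \<open>M ^ m\<close>. The vectors are not assumed normalised, so rescaled ones may be
  inserted.\<close>

lemma rep_tuple_bound:
  assumes p: "1 \<le> p" and m: "(\<Sum>i<n. k i) = m" "m > 0" and L: "sym_mlin_form p m L"
    and x: "\<forall>i<n. in_lp p (x i)"
    and M: "\<And>\<epsilon>. \<epsilon> \<in> signs m \<Longrightarrow> lp_norm p (\<lambda>t. \<Sum>i<n. sign_sum n k \<epsilon> i * x i t) \<le> M \<epsilon>"
      "\<And>\<epsilon>. \<epsilon> \<in> signs m \<Longrightarrow> M \<epsilon> \<ge> 0"
    and B: "(\<Sum>\<epsilon>\<in>signs m. M \<epsilon> ^ m) \<le> 2 ^ m * B"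
  shows "\<bar>L (rep_tuple n k x)\<bar> \<le> B / fact m * poly_norm p m L"
proof -
  have "\<bar>L (rep_tuple n k x)\<bar> \<le> (\<Sum>\<epsilon>\<in>signs m. M \<epsilon> ^ m) / (2 ^ m * fact m) * poly_norm p m L"
    unfolding rep_tuple_eq_map
  proof (rule polarization_bound[OF p L m(2)])
    show "length (map x (index_list n k)) = m" using m by (simp add: length_index_list)
    show "\<forall>z\<in>set (map x (index_list n k)). in_lp p z" using x by (auto simp: set_index_list)
    show "lp_norm p (\<lambda>t. \<Sum>j<m. \<epsilon> j * (map x (index_list n k) ! j) t) \<le> M \<epsilon>"
      if "\<epsilon> \<in> signs m" for \<epsilon>
      using M(1)[OF that] sum_index_list[where n = n and k = k and y = x] m(1) by simp
  qed (rule M(2))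
  also have "\<dots> \<le> 2 ^ m * B / (2 ^ m * fact m) * poly_norm p m L"
    by (intro mult_right_mono divide_right_mono B poly_norm_nonneg[OF p L]) auto
  finally show ?thesis by simp
qed

text \<open>With \<open>y i = x i / k i\<close> the coefficients
  \<open>sign_sum n k \<epsilon> i / k i\<close> are at most 1 in absolute value, so for every
  choice of signs the norm is at most \<open>n powr (1 / p)\<close>, or 1 if \<open>p\<close> is
  infinite. Multilinearity turns the rescaling into the factor \<open>K\<close>.\<close>

lemma admissible_upper1:
  assumes p: "1 \<le> p" and m: "(\<Sum>i<n. k i) = m" "m > 0"
  shows "admissible p n k ((\<Prod>i<n. real (k i) ^ k i) / fact m * ppow p (real n) (real m))"
  unfolding admissible_def m(1)
proof (intro allI impI, elim conjE)
  fix L x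
  assume L: "sym_mlin_form p m L" and x: "\<forall>i<n. in_lp p (x i) \<and> lp_norm p (x i) = 1"
    and d: "\<forall>i<n. \<forall>j<n. i \<noteq> j \<longrightarrow> (\<forall>t. x i t = 0 \<or> x j t = 0)"
  \<comment> \<open>If \<open>k i = 0\<close>, division by zero makes \<open>y i\<close> the zero
    sequence; this is harmless, since \<open>x i\<close> then does not occur in the tuple and
    contributes \<open>0 ^ 0 = 1\<close> to \<open>K\<close>.\<close>
  define y where "y = (\<lambda>i t. (1 / real (k i)) * x i t)"
  have n: "n > 0" using m by (cases n) auto
  have y: "\<forall>i<n. in_lp p (y i)" using x by (auto simp: y_def simp del: times_divide_eq_left intro!: in_lp_scale p)
  define K where "K = (\<Prod>i<n. real (k i) ^ k i)"
  have "K > 0" unfolding K_def by (rule prod_pos) auto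
  define M where "M = (if p = \<infinity> then 1 else real n powr (1 / real_of_ereal p))"
  have M0: "M > 0" using n by (simp add: M_def)
  have MM: "M ^ m = ppow p (real n) (real m)"
    using n by (auto simp: M_def ppow_def powr_powr simp flip: powr_realpow)
  have le1: "\<bar>sign_sum n k \<epsilon> i * (1 / real (k i))\<bar> \<le> 1" if "\<epsilon> \<in> signs m" "i < n" for \<epsilon> i
    using abs_sign_sum_le[of \<epsilon> k n i] that m(1) by (cases "k i = 0") (auto simp: abs_mult field_simps)
  have yx: "(\<lambda>t. \<Sum>i<n. sign_sum n k \<epsilon> i * y i t) = (\<lambda>t. \<Sum>i<n. (sign_sum n k \<epsilon> i * (1 / real (k i))) * x i t)" for \<epsilon>
    by (simp add: y_def mult.assoc)
  have norm: "lp_norm p (\<lambda>t. \<Sum>i<n. sign_sum n k \<epsilon> i * y i t) \<le> M" if \<epsilon>: "\<epsilon> \<in> signs m" for \<epsilon>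
    using p
  proof (cases rule: ereal_ge_1_cases)
    case inf
    have "lp_norm p (\<lambda>t. \<Sum>i<n. sign_sum n k \<epsilon> i * y i t) \<le> 1"
      unfolding yx inf by (rule linf_norm_disjoint_sum) (use inf x d le1[OF \<epsilon>] in auto)
    thus ?thesis using inf by (simp add: M_def)
  next
    case (real q)
    have "lp_norm p (\<lambda>t. \<Sum>i<n. sign_sum n k \<epsilon> i * y i t) = (\<Sum>i<n. \<bar>sign_sum n k \<epsilon> i * (1 / real (k i))\<bar> powr q) powr (1 / q)"
      unfolding yx real(1) by (rule lp_norm_disjoint_sum) (use real x d in auto)
    also have "\<dots> \<le> (\<Sum>i<n. 1) powr (1 / q)"
      by (intro powr_mono2 sum_mono powr_le1 sum_nonneg) (use real le1[OF \<epsilon>] in auto)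
    finally show ?thesis using real by (simp add: M_def)
  qed
  have "\<bar>L (rep_tuple n k y)\<bar> \<le> M ^ m / fact m * poly_norm p m L"
    using M0 by (intro rep_tuple_bound[OF p m L y norm]) (auto simp: card_signs)
  moreover have "L (rep_tuple n k y) = prod_list (map (\<lambda>i. 1 / real (k i)) (index_list n k)) * L (rep_tuple n k x)"
    using sym_mlin_form_map_scale[OF p L, of "[]" "index_list n k" x "\<lambda>i. 1 / real (k i)"] x m(1)
    by (simp add: rep_tuple_eq_map y_def length_index_list set_index_list)
  moreover have "prod_list (map (\<lambda>i. 1 / real (k i)) (index_list n k)) = 1 / K"
    by (subst prod_list_eq_prod_count[of "{..<n}"])
       (auto simp: set_index_list count_index_list K_def power_one_over prod_dividef)
  ultimately show "\<bar>L (rep_tuple n k x)\<bar> \<le> K / fact m * ppow p (real n) (real m) * poly_norm p m L"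
    using \<open>K > 0\<close> MM by (simp add: abs_mult field_simps)
qed

section \<open>The second upper bound from moments of sign sums\<close>

text \<open>The moment bound involves \<open>k i powr (q / 2)\<close>, which is at most
  \<open>k i * m powr (q / 2 - 1)\<close>; now the \<open>k i\<close> add up to \<open>m\<close>,
  and no factor \<open>n\<close> appears.\<close>

lemma sum_powr_sign_sum_le:
  assumes m: "(\<Sum>i<n. k i) = m" and q: "q \<ge> 1" "q \<ge> 2 \<or> m = 1"
  shows "(\<Sum>\<epsilon>\<in>signs m. \<Sum>i<n. \<bar>sign_sum n k \<epsilon> i\<bar> powr q)
    \<le> 2 ^ m * (q * 2 powr (q / 2) * Gamma (q / 2) * real m powr (q / 2))"
proof -
  define D where "D = q * 2 powr (q / 2) * Gamma (q / 2)"
  have D: "D \<ge> 0" using q by (simp add: D_def Gamma_real_pos less_imp_le)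
  have "(\<Sum>\<epsilon>\<in>signs m. \<Sum>i<n. \<bar>sign_sum n k \<epsilon> i\<bar> powr q) = (\<Sum>i<n. \<Sum>\<epsilon>\<in>signs m. \<bar>sign_sum n k \<epsilon> i\<bar> powr q)"
    by (rule sum.swap)
  also have "\<dots> \<le> (\<Sum>i<n. 2 ^ m * (D * (real (k i) * real m powr (q / 2 - 1))))"
  proof (rule sum_mono)
    fix i assume i: "i \<in> {..<n}"
    have kim: "k i \<le> m" using i m member_le_sum[of i "{..<n}" k] by auto
    have "(\<Sum>\<epsilon>\<in>signs m. \<bar>sign_sum n k \<epsilon> i\<bar> powr q)
       \<le> 2 ^ m * (D * real (k i) powr (q / 2))"
      using moment_signs[of "{j. j < m \<and> index_list n k ! j = i}" m q] q i card_index_class[of k n i] m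
      by (auto simp: sign_sum_def D_def)
    also have "real (k i) powr (q / 2) \<le> real (k i) * real m powr (q / 2 - 1)"
    proof (cases "k i = 0")
      case False
      have "real (k i) powr (q / 2) = real (k i) * real (k i) powr (q / 2 - 1)"
        using False by (simp add: powr_diff)
      also have "real (k i) powr (q / 2 - 1) \<le> real m powr (q / 2 - 1)"
      \<comment> \<open>For \<open>m = 1\<close> the exponent may be negative, but both bases equal
        1; otherwise \<open>q \<ge> 2\<close> makes it nonnegative.\<close>
      proof (cases "m = 1")
        case True
        hence "k i = 1" using kim False by simp
        thus ?thesis using True by simp
      next
        case False
        thus ?thesis using q kim by (intro powr_mono2) auto
      qed
      finally show ?thesis by (simp add: mult_left_mono)
    qed simp
    finally show "(\<Sum>\<epsilon>\<in>signs m. \<bar>sign_sum n k \<epsilon> i\<bar> powr q) \<le> 2 ^ m * (D * (real (k i) * real m powr (q / 2 - 1)))"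
      using D by (simp add: mult_left_mono)
  qed
  also have "\<dots> = 2 ^ m * (D * ((\<Sum>i<n. real (k i)) * real m powr (q / 2 - 1)))"
    by (simp add: sum_distrib_left sum_distrib_right)
  also have "(\<Sum>i<n. real (k i)) = real m" using m by (simp flip: of_nat_sum)
  also have "real m * real m powr (q / 2 - 1) = real m powr (q / 2)"
    by (cases "m = 0") (auto simp: powr_diff)
  finally show ?thesis by (simp add: D_def)
qed

text \<open>For finite exponent the norm in the polarization formula is known exactly, and its
  \<open>m\<close>-th power is the summand in the hypothesis. Both cases of the second upper bound
  reduce to estimating this mean.\<close>

lemma admissible_of_mean_bound:
  assumes q: "q \<ge> 1" and m: "(\<Sum>i<n. k i) = m" "m > 0"
    and B: "(\<Sum>\<epsilon>\<in>signs m. (\<Sum>i<n. \<bar>sign_sum n k \<epsilon> i\<bar> powr q) powr (real m / q)) \<le> 2 ^ m * B"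
  shows "admissible (ereal q) n k (B / fact m)"
  unfolding admissible_def m(1)
proof (intro allI impI, elim conjE)
  fix L x
  assume L: "sym_mlin_form (ereal q) m L"
    and x: "\<forall>i<n. in_lp (ereal q) (x i) \<and> lp_norm (ereal q) (x i) = 1"
    and d: "\<forall>i<n. \<forall>j<n. i \<noteq> j \<longrightarrow> (\<forall>t. x i t = 0 \<or> x j t = 0)"
  define M where "M = (\<lambda>\<epsilon>. (\<Sum>i<n. \<bar>sign_sum n k \<epsilon> i\<bar> powr q) powr (1 / q))"
  have p: "1 \<le> ereal q" using q by simp
  have "M \<epsilon> ^ m = (\<Sum>i<n. \<bar>sign_sum n k \<epsilon> i\<bar> powr q) powr (real m / q)" for \<epsilon>
    using m(2) by (cases "M \<epsilon> = 0") (auto simp: M_def powr_powr zero_power simp flip: powr_realpow)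
  hence "(\<Sum>\<epsilon>\<in>signs m. M \<epsilon> ^ m) \<le> 2 ^ m * B" using B by simp
  thus "\<bar>L (rep_tuple n k x)\<bar> \<le> B / fact m * poly_norm (ereal q) m L"
    using x by (intro rep_tuple_bound[where M = M, OF p m L])
      (auto simp: M_def lp_norm_disjoint_sum[OF q x d])
qed

lemma admissible_upper2_ge:
  assumes q: "q \<ge> 1" and m: "(\<Sum>i<n. k i) = m" "m > 0" and qm: "q \<ge> real m"
  shows "admissible (ereal q) n k (q * 2 powr (q / 2) * Gamma (q / 2) * real m powr (q / 2) / fact m)"
proof (rule admissible_of_mean_bound[OF q m])
  have "(\<Sum>\<epsilon>\<in>signs m. (\<Sum>i<n. \<bar>sign_sum n k \<epsilon> i\<bar> powr q) powr (real m / q))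
      \<le> (\<Sum>\<epsilon>\<in>signs m. \<Sum>i<n. \<bar>sign_sum n k \<epsilon> i\<bar> powr q)"
  proof (rule sum_mono)
    fix \<epsilon> assume \<epsilon>: "\<epsilon> \<in> signs m"
    let ?Y = "\<Sum>i<n. \<bar>sign_sum n k \<epsilon> i\<bar> powr q"
    \<comment> \<open>the sums of signs are integers, so \<open>?Y\<close> vanishes or is at least 1\<close>
    show "?Y powr (real m / q) \<le> ?Y"
    proof (cases "\<exists>i<n. sign_sum n k \<epsilon> i \<noteq> 0")
      case False
      thus ?thesis using q by simp
    next
      case True
      then obtain i where i: "i < n" "sign_sum n k \<epsilon> i \<noteq> 0" by blast
      have "1 \<le> \<bar>sign_sum n k \<epsilon> i\<bar> powr q"
        using abs_sign_sum_zero_or_ge_1[of \<epsilon> k n i] \<epsilon> i m(1) q by (intro ge_one_powr_ge_zero) auto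
      also have "\<dots> \<le> ?Y"
        using i by (intro member_le_sum) auto
      finally have "1 \<le> ?Y" .
      hence "?Y powr (real m / q) \<le> ?Y powr 1"
        using qm q by (intro powr_mono) auto
      thus ?thesis using \<open>1 \<le> ?Y\<close> by simp
    qed
  qed
  also have "\<dots> \<le> 2 ^ m * (q * 2 powr (q / 2) * Gamma (q / 2) * real m powr (q / 2))"
    \<comment> \<open>If \<open>q < 2\<close>, then \<open>m \<le> q\<close> forces
      \<open>m = 1\<close>.\<close>
    by (rule sum_powr_sign_sum_le[OF m(1) q]) (use qm m(2) in linarith)
  finally show "(\<Sum>\<epsilon>\<in>signs m. (\<Sum>i<n. \<bar>sign_sum n k \<epsilon> i\<bar> powr q) powr (real m / q))
      \<le> 2 ^ m * (q * 2 powr (q / 2) * Gamma (q / 2) * real m powr (q / 2))" .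
qed

text \<open>Jensen's inequality for the convex power \<open>r\<close> with equal weights; clearing
  the weights leaves the factor with exponent \<open>r - 1\<close>.\<close>

lemma power_mean_powr:
  fixes a :: "'a \<Rightarrow> real"
  assumes "finite A" "r \<ge> 1" "\<And>i. i \<in> A \<Longrightarrow> a i \<ge> 0"
  shows "(\<Sum>i\<in>A. a i) powr r \<le> real (card A) powr (r - 1) * (\<Sum>i\<in>A. a i powr r)"
proof -
  \<comment> \<open>Zero terms are discarded so that convexity is applied at positive points.
    Putting them back only enlarges the cardinality factor.\<close>
  define S where "S = {i\<in>A. a i > 0}"
  have S: "finite S" "S \<subseteq> A" using assms(1) by (auto simp: S_def)
  have off: "a i = 0" if "i \<in> A - S" for i
    using that assms(3)[of i] by (auto simp: S_def)
  have e1: "(\<Sum>i\<in>A. a i) = (\<Sum>i\<in>S. a i)"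
    by (rule sum.mono_neutral_right) (use assms(1) S off in auto)
  have e2: "(\<Sum>i\<in>A. a i powr r) = (\<Sum>i\<in>S. a i powr r)"
    by (rule sum.mono_neutral_right) (use assms(1) S off in auto)
  show ?thesis
  proof (cases "S = {}")
    case True
    then show ?thesis using e1 e2 by simp
  next
    case False
    define N where "N = real (card S)"
    have N: "N > 0" using False S by (auto simp: N_def card_gt_0_iff)
    have "(\<Sum>i\<in>S. (1/N) *\<^sub>R a i) powr r \<le> (\<Sum>i\<in>S. (1/N) * a i powr r)"
      by (rule convex_on_sum[OF S(1) False powr_convex[OF assms(2)]])
         (use N in \<open>auto simp: S_def N_def\<close>)
    hence "(\<Sum>i\<in>S. a i) powr r / N powr r \<le> (\<Sum>i\<in>S. a i powr r) / N"
      using N by (simp add: sum_divide_distrib[symmetric] powr_divide sum_nonneg S_def)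
    hence "(\<Sum>i\<in>S. a i) powr r \<le> N powr (r - 1) * (\<Sum>i\<in>S. a i powr r)"
      using N by (simp add: powr_diff field_simps)
    also have "\<dots> \<le> real (card A) powr (r - 1) * (\<Sum>i\<in>S. a i powr r)"
      using S assms(1,2) by (intro mult_right_mono powr_mono2 sum_nonneg) (auto simp: N_def intro: card_mono)
    finally show ?thesis using e1 e2 by simp
  qed
qed

text \<open>Now \<open>m / q > 1\<close>, and the power mean inequality over \<open>n\<close> terms
  moves this exponent inside at the cost of \<open>n powr (m / q - 1)\<close>. What remains is a sum
  of \<open>m\<close>-th moments.\<close>

lemma admissible_upper2_less:
  assumes q: "q \<ge> 1" and m: "(\<Sum>i<n. k i) = m" and qm: "q < real m"
  shows "admissible (ereal q) n k (real n powr ((real m - q) / q) * real m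
                 * 2 powr (real m / 2) * Gamma (real m / 2) * real m powr (real m / 2) / fact m)"
proof (rule admissible_of_mean_bound[OF q m])
  show "m > 0" using q qm by (cases m) auto
  have m2: "m \<ge> 2" using q qm by linarith
  have "(\<Sum>\<epsilon>\<in>signs m. (\<Sum>i<n. \<bar>sign_sum n k \<epsilon> i\<bar> powr q) powr (real m / q))
      \<le> (\<Sum>\<epsilon>\<in>signs m. real n powr ((real m - q) / q) * (\<Sum>i<n. \<bar>sign_sum n k \<epsilon> i\<bar> powr real m))"
  proof (rule sum_mono)
    fix \<epsilon>
    have "(\<Sum>i<n. \<bar>sign_sum n k \<epsilon> i\<bar> powr q) powr (real m / q)
        \<le> real (card {..<n}) powr (real m / q - 1) * (\<Sum>i<n. (\<bar>sign_sum n k \<epsilon> i\<bar> powr q) powr (real m / q))"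
      by (rule power_mean_powr) (use q qm in auto)
    thus "(\<Sum>i<n. \<bar>sign_sum n k \<epsilon> i\<bar> powr q) powr (real m / q)
       \<le> real n powr ((real m - q) / q) * (\<Sum>i<n. \<bar>sign_sum n k \<epsilon> i\<bar> powr real m)"
      using q by (simp add: powr_powr diff_divide_distrib)
  qed
  also have "\<dots> = real n powr ((real m - q) / q) * (\<Sum>\<epsilon>\<in>signs m. \<Sum>i<n. \<bar>sign_sum n k \<epsilon> i\<bar> powr real m)"
    by (simp add: sum_distrib_left)
  also have "\<dots> \<le> real n powr ((real m - q) / q) *
      (2 ^ m * (real m * 2 powr (real m / 2) * Gamma (real m / 2) * real m powr (real m / 2)))"
    by (intro mult_left_mono sum_powr_sign_sum_le[OF m]) (use m2 in auto)
  finally show "(\<Sum>\<epsilon>\<in>signs m. (\<Sum>i<n. \<bar>sign_sum n k \<epsilon> i\<bar> powr q) powr (real m / q))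
     \<le> 2 ^ m * (real n powr ((real m - q) / q) * real m
                 * 2 powr (real m / 2) * Gamma (real m / 2) * real m powr (real m / 2))"
    by (simp only: mult_ac)
qed

section \<open>Lower bound\<close>

text \<open>The symmetric form whose diagonal is the monomial with exponents given by the letter
  counts of \<open>gs\<close>. The average runs over distinct rearrangements of \<open>gs\<close>,
  each counted once.\<close>

definition monomial_form :: "nat list \<Rightarrow> (nat \<Rightarrow> real) list \<Rightarrow> real" where
  "monomial_form gs xs = (\<Sum>zs\<in>permutations_of_multiset (mset gs). \<Prod>i<length gs. (xs ! i) (zs ! i))
     / real (card (permutations_of_multiset (mset gs)))"

lemma card_permutations_of_mset_pos: "card (permutations_of_multiset (mset gs)) > 0"
  using permutations_of_multisetI[of gs "mset gs"] by (auto simp: card_gt_0_iff)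

lemma length_permutation_of_mset: "zs \<in> permutations_of_multiset (mset gs) \<Longrightarrow> length zs = length gs"
  by (auto simp: permutations_of_multiset_def dest: mset_eq_length)

lemma monomial_form_linear:
  assumes i: "i < length gs" and len: "length xs = length gs"
  shows "monomial_form gs (xs[i := (\<lambda>t. a * x t + b * y t)])
       = a * monomial_form gs (xs[i := x]) + b * monomial_form gs (xs[i := y])"
proof -
  have *: "(\<Prod>j<length gs. (xs[i := v] ! j) (zs ! j)) = v (zs ! i) * (\<Prod>j\<in>{..<length gs} - {i}. (xs ! j) (zs ! j))"
    for v and zs :: "nat list"
  proof -
    have "(\<Prod>j<length gs. (xs[i := v] ! j) (zs ! j))
        = (xs[i := v] ! i) (zs ! i) * (\<Prod>j\<in>{..<length gs} - {i}. (xs[i := v] ! j) (zs ! j))"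
      by (rule prod.remove) (use i in auto)
    also have "(\<Prod>j\<in>{..<length gs} - {i}. (xs[i := v] ! j) (zs ! j)) = (\<Prod>j\<in>{..<length gs} - {i}. (xs ! j) (zs ! j))"
      by (rule prod.cong) auto
    finally show ?thesis using i len by simp
  qed
  show ?thesis
    unfolding monomial_form_def *
    by (simp add: ring_distribs sum.distrib sum_distrib_left add_divide_distrib mult.assoc)
qed

text \<open>Permuting the arguments has the same effect as permuting the letters of each word by the
  inverse, and this maps the set of rearrangements bijectively onto itself.\<close>

lemma monomial_form_symmetric:
  assumes len: "length xs = length gs" and "mset ys = mset xs"
  shows "monomial_form gs ys = monomial_form gs xs"
proof -
  let ?m = "length gs" and ?P = "permutations_of_multiset (mset gs)"
  obtain \<pi> where \<pi>: "\<pi> permutes {..<?m}" "permute_list \<pi> xs = ys"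
    using mset_eq_permutation[OF assms(2)] len by metis
  have \<pi>': "inv \<pi> permutes {..<?m}" by (rule permutes_inv[OF \<pi>(1)])
  have "(\<Sum>zs\<in>?P. \<Prod>i<?m. (ys ! i) (zs ! i)) = (\<Sum>zs\<in>?P. \<Prod>i<?m. (xs ! i) (zs ! i))"
  proof (rule sum.reindex_bij_witness[of _ "permute_list \<pi>" "permute_list (inv \<pi>)"])
    fix zs assume zs: "zs \<in> ?P"
    have lz: "length zs = ?m" by (rule length_permutation_of_mset[OF zs])
    show "permute_list (inv \<pi>) zs \<in> ?P" "permute_list \<pi> zs \<in> ?P"
      using zs lz \<pi>(1) \<pi>' by (auto simp: permutations_of_multiset_def)
    show "permute_list \<pi> (permute_list (inv \<pi>) zs) = zs"
      using permute_list_compose[of "\<pi>" zs "inv \<pi>"] permute_list_compose[of "inv \<pi>" zs "\<pi>"] \<pi>(1) \<pi>' lz permutes_inv_o[OF \<pi>(1)]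
      by simp
    show "permute_list (inv \<pi>) (permute_list \<pi> zs) = zs"
      using permute_list_compose[of "\<pi>" zs "inv \<pi>"] permute_list_compose[of "inv \<pi>" zs "\<pi>"] \<pi>(1) \<pi>' lz permutes_inv_o[OF \<pi>(1)]
      by simp
    have "(\<Prod>i<?m. (ys ! i) (zs ! i)) = (\<Prod>i<?m. (xs ! \<pi> i) (zs ! i))"
      by (rule prod.cong) (use \<pi> len in \<open>auto simp: permute_list_nth[symmetric]\<close>)
    also have "\<dots> = (\<Prod>i<?m. (xs ! i) (zs ! inv \<pi> i))"
    proof -
      have "(\<Prod>i<?m. (xs ! i) (zs ! inv \<pi> i)) = (\<Prod>i<?m. (xs ! \<pi> i) (zs ! inv \<pi> (\<pi> i)))"
        by (rule prod.reindex_bij_betw[symmetric, OF permutes_imp_bij[OF \<pi>(1)]])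
      thus ?thesis using permutes_inverses(2)[OF \<pi>(1)] by simp
    qed
    also have "\<dots> = (\<Prod>i<?m. (xs ! i) (permute_list (inv \<pi>) zs ! i))"
      by (rule prod.cong) (use \<pi>' lz in \<open>auto simp: permute_list_nth\<close>)
    finally show "(\<Prod>i<?m. (xs ! i) (permute_list (inv \<pi>) zs ! i)) = (\<Prod>i<?m. (ys ! i) (zs ! i))"
      by simp
  qed
  thus ?thesis by (simp add: monomial_form_def)
qed

lemma abs_monomial_form_le:
  assumes p: "1 \<le> p" and len: "length xs = length gs" and xs: "\<forall>z\<in>set xs. in_lp p z"
  shows "\<bar>monomial_form gs xs\<bar> \<le> prod_list (map (lp_norm p) xs)"
proof -
  let ?m = "length gs" and ?P = "permutations_of_multiset (mset gs)"
  have "\<bar>\<Sum>zs\<in>?P. \<Prod>i<?m. (xs ! i) (zs ! i)\<bar> \<le> (\<Sum>zs\<in>?P. \<Prod>i<?m. lp_norm p (xs ! i))"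
  proof (rule order_trans[OF sum_abs], rule sum_mono)
    fix zs
    show "\<bar>\<Prod>i<?m. (xs ! i) (zs ! i)\<bar> \<le> (\<Prod>i<?m. lp_norm p (xs ! i))"
      unfolding abs_prod by (rule prod_mono) (use len xs in \<open>auto intro!: coord_le_lp_norm p\<close>)
  qed
  also have "\<dots> = real (card ?P) * prod_list (map (lp_norm p) xs)"
    using len by (simp add: prod.list_conv_set_nth atLeast0LessThan)
  finally show ?thesis
    using card_permutations_of_mset_pos[of gs] by (simp add: monomial_form_def field_simps)
qed

lemma sym_mlin_form_monomial_form:
  assumes "1 \<le> p"
  shows "sym_mlin_form p (length gs) (monomial_form gs)"
  unfolding sym_mlin_form_def
proof (intro conjI exI[of _ 1] allI impI)
  fix xs assume "length xs = length gs \<and> (\<forall>z\<in>set xs. in_lp p z)"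
  thus "\<bar>monomial_form gs xs\<bar> \<le> 1 * prod_list (map (lp_norm p) xs)"
    using abs_monomial_form_le[OF assms] by simp
qed (blast intro: monomial_form_linear monomial_form_symmetric)+

lemma monomial_form_diagonal:
  assumes "finite A" "set gs \<subseteq> A"
  shows "monomial_form gs (replicate (length gs) x) = (\<Prod>i\<in>A. x i ^ count_list gs i)"
proof -
  let ?P = "permutations_of_multiset (mset gs)"
  have "(\<Prod>i<length gs. (replicate (length gs) x ! i) (zs ! i)) = (\<Prod>i\<in>A. x i ^ count_list gs i)"
    if zs: "zs \<in> ?P" for zs
  proof -
    have "(\<Prod>i<length gs. (replicate (length gs) x ! i) (zs ! i)) = prod_list (map x zs)"
      using length_permutation_of_mset[OF zs]
      by (simp add: prod.list_conv_set_nth atLeast0LessThan)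
    also have "\<dots> = prod_list (map x gs)"
      using zs by (metis mset_map permutations_of_multisetD prod_mset_prod_list)
    finally show ?thesis using prod_list_eq_prod_count[OF assms] by simp
  qed
  thus ?thesis using card_permutations_of_mset_pos[of gs] by (simp add: monomial_form_def)
qed

definition unit_seq :: "nat \<Rightarrow> nat \<Rightarrow> real" where
  "unit_seq i t = (if t = i then 1 else 0)"

text \<open>Any rearrangement other than \<open>gs\<close> itself disagrees with it at some
  position, where the unit vector contributes a zero factor.\<close>

lemma monomial_form_unit_seq:
  "monomial_form gs (map unit_seq gs) = 1 / real (card (permutations_of_multiset (mset gs)))"
proof -
  let ?P = "permutations_of_multiset (mset gs)"
  have "(\<Prod>i<length gs. (map unit_seq gs ! i) (zs ! i)) = (if zs = gs then 1 else 0)" if zs: "zs \<in> ?P" for zs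
  proof (cases "zs = gs")
    case True
    thus ?thesis by (simp add: unit_seq_def)
  next
    case False
    then obtain i where "i < length gs" "zs ! i \<noteq> gs ! i"
      using length_permutation_of_mset[OF zs] nth_equalityI by metis
    thus ?thesis using False by (auto simp: unit_seq_def intro!: prod_zero)
  qed
  hence "(\<Sum>zs\<in>?P. \<Prod>i<length gs. (map unit_seq gs ! i) (zs ! i)) = (\<Sum>zs\<in>?P. if zs = gs then 1 else 0)"
    by (rule sum.cong[OF refl])
  also have "\<dots> = 1" using permutations_of_multisetI[of gs "mset gs"] by simp
  finally show ?thesis by (simp add: monomial_form_def)
qed

lemma unit_seq_lp:
  assumes "1 \<le> p"
  shows "in_lp p (unit_seq i)" "lp_norm p (unit_seq i) = 1"
proof -
  have "in_lp p (unit_seq i) \<and> lp_norm p (unit_seq i) = 1"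
    using assms
  proof (cases rule: ereal_ge_1_cases)
    case (real q)
    have "(\<lambda>t. \<bar>unit_seq i t\<bar> powr q) = (\<lambda>t. if t = i then 1 else 0)"
      using real by (auto simp: unit_seq_def)
    moreover have "(\<lambda>t. if t = i then 1 else 0) sums (1::real)"
      using sums_single[of i "\<lambda>_. 1"] by simp
    ultimately show ?thesis using real by (simp add: in_lp_def lp_norm_def sums_iff)
  next
    case inf
    have b: "bounded (range (unit_seq i))"
      by (rule boundedI[of _ 1]) (auto simp: unit_seq_def)
    have "(SUP t. \<bar>unit_seq i t\<bar>) = 1"
      by (rule cSup_eq_maximum) (auto simp: unit_seq_def image_iff intro!: exI[of _ i])
    thus ?thesis using inf b by (simp add: in_lp_def lp_norm_def)
  qed
  thus "in_lp p (unit_seq i)" "lp_norm p (unit_seq i) = 1" by auto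
qed

section \<open>The norm of a monomial\<close>

text \<open>Weighted AM-GM, derived from \<open>b \<le> exp (b - 1)\<close> at
  \<open>b = a i * m / k i\<close>. The \<open>k i\<close>-th powers have exponents
  \<open>m * a i - k i\<close>, whose sum is at most zero because the \<open>a i\<close> add up to
  at most 1.\<close>

lemma weighted_prod_le:
  fixes n :: nat
  assumes a: "\<And>i. i < n \<Longrightarrow> a i \<ge> 0" "(\<Sum>i<n. a i) \<le> 1" and m: "(\<Sum>i<n. k i) = (m::nat)"
  shows "(\<Prod>i<n. a i ^ k i) \<le> (\<Prod>i<n. real (k i) ^ k i) / real m ^ m"
proof -
  have *: "a i ^ k i * real m ^ k i \<le> real (k i) ^ k i * exp (real m * a i - real (k i))" if "i < n" for i
  proof (cases "k i = 0")
    case False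
    define b where "b = a i * real m / real (k i)"
    have "b \<ge> 0" using a that by (simp add: b_def)
    have "b \<le> exp (b - 1)" using exp_ge_add_one_self[of "b - 1"] by simp
    hence "b ^ k i \<le> exp (b - 1) ^ k i" using \<open>b \<ge> 0\<close> by (rule power_mono)
    also have "\<dots> = exp (real (k i) * (b - 1))" by (rule exp_of_nat_mult[symmetric])
    also have "real (k i) * (b - 1) = real m * a i - real (k i)"
      using False by (simp add: b_def field_simps)
    finally show ?thesis using False
      by (simp add: b_def power_mult_distrib power_divide field_simps)
  next
    case True
    thus ?thesis using a that by simp
  qed
  have km: "(\<Sum>i<n. real (k i)) = real m" using m by (simp flip: of_nat_sum)
  have "(\<Prod>i<n. a i ^ k i) * real m ^ m = (\<Prod>i<n. a i ^ k i * real m ^ k i)"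
    unfolding m[symmetric] by (simp add: prod.distrib power_sum)
  also have "\<dots> \<le> (\<Prod>i<n. real (k i) ^ k i * exp (real m * a i - real (k i)))"
    by (rule prod_mono) (use * a in auto)
  also have "\<dots> = (\<Prod>i<n. real (k i) ^ k i) * exp (\<Sum>i<n. real m * a i - real (k i))"
    by (simp add: prod.distrib exp_sum)
  also have "\<dots> \<le> (\<Prod>i<n. real (k i) ^ k i) * 1"
  proof (rule mult_left_mono)
    have "(\<Sum>i<n. real m * a i - real (k i)) = real m * (\<Sum>i<n. a i) - real m"
      by (simp add: sum_subtractf sum_distrib_left km)
    thus "exp (\<Sum>i<n. real m * a i - real (k i)) \<le> 1"
      using mult_left_mono[OF a(2), of "real m"] by simp
  qed (simp add: prod_nonneg)
  finally have "(\<Prod>i<n. a i ^ k i) * real m ^ m \<le> (\<Prod>i<n. real (k i) ^ k i)" by simp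
  moreover have "real m ^ m > 0" by (cases "m = 0") auto
  ultimately show ?thesis by (simp add: pos_le_divide_eq)
qed

text \<open>At \<open>j = 0\<close> the special clause of \<open>ppow\<close> agrees with
  \<open>0 ^ 0 = 1\<close>, whereas \<open>0 powr 0 = 0\<close>.\<close>

lemma power_powr_inverse: "(real j ^ j) powr (1 / q) = ppow (ereal q) (real j) (real j)"
  by (cases "j = 0") (auto simp: ppow_def powr_powr simp flip: powr_realpow)

lemma ppow_pos: "ppow p (real j) (real j) > 0"
  by (auto simp: ppow_def)

text \<open>For finite \<open>q\<close> the numbers \<open>\<bar>x i\<bar> powr q\<close> have sum
  at most 1, so \<open>weighted_prod_le\<close> applies and a \<open>q\<close>-th root is taken. For
  infinite \<open>p\<close> every factor is at most 1.\<close>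

lemma abs_monomial_le:
  assumes p: "1 \<le> p" and x: "in_lp p x" "lp_norm p x \<le> 1" and m: "(\<Sum>i<n. k i) = m"
  shows "\<bar>\<Prod>i<n. x i ^ k i\<bar> \<le> (\<Prod>i<n. ppow p (real (k i)) (real (k i))) / ppow p (real m) (real m)"
  using p
proof (cases rule: ereal_ge_1_cases)
  case inf
  have "\<bar>x i\<bar> \<le> 1" for i using coord_le_lp_norm[OF p x(1), of i] x(2) by linarith
  hence "(\<Prod>i<n. \<bar>x i\<bar> ^ k i) \<le> 1" by (intro prod_le_1) (auto intro: power_le_one)
  thus ?thesis using inf by (simp add: abs_prod power_abs ppow_def)
next
  case (real q)
  define P where "P = (\<Prod>i<n. \<bar>x i\<bar> ^ k i)"
  have sm: "summable (\<lambda>i. \<bar>x i\<bar> powr q)" using x(1) real by (simp add: in_lp_def)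
  have "(\<Sum>i<n. \<bar>x i\<bar> powr q) \<le> (\<Sum>i. \<bar>x i\<bar> powr q)"
    by (rule sum_le_suminf[OF sm]) auto
  also have "\<dots> = lp_norm p x powr q"
    using suminf_nonneg[OF sm] real by (simp add: lp_norm_def powr_powr)
  also have "\<dots> \<le> 1"
    using x lp_norm_nonneg[OF p x(1)] real by (intro powr_le1) auto
  finally have "(\<Prod>i<n. (\<bar>x i\<bar> powr q) ^ k i) \<le> (\<Prod>i<n. real (k i) ^ k i) / real m ^ m"
    by (intro weighted_prod_le m) auto
  also have "(\<Prod>i<n. (\<bar>x i\<bar> powr q) ^ k i) = P powr q"
  proof -
    have "(\<bar>x i\<bar> powr q) ^ j = (\<bar>x i\<bar> ^ j) powr q" for i j
      by (induction j) (simp_all add: powr_mult)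
    thus ?thesis by (simp add: P_def prod_powr_distrib)
  qed
  finally have "(P powr q) powr (1 / q) \<le> ((\<Prod>i<n. real (k i) ^ k i) / real m ^ m) powr (1 / q)"
    using real by (intro powr_mono2) auto
  moreover have "(P powr q) powr (1 / q) = P"
    using real by (simp add: powr_powr P_def prod_nonneg)
  ultimately show ?thesis
    unfolding real(1)
    by (simp add: powr_divide prod_nonneg prod_powr_distrib power_powr_inverse P_def abs_prod power_abs)
qed

text \<open>The number of distinct rearrangements is a multinomial coefficient.\<close>

lemma fact_div_card_index_list:
  assumes "(\<Sum>i<n. k i) = m"
  shows "1 / real (card (permutations_of_multiset (mset (index_list n k)))) = (\<Prod>i<n. fact (k i)) / fact m"
proof -
  let ?gs = "index_list n k"
  let ?N = "card (permutations_of_multiset (mset ?gs))"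
  have "(\<Prod>i\<in>set_mset (mset ?gs). fact (count (mset ?gs) i)) = (\<Prod>i<n. fact (k i) :: nat)"
    by (rule prod.mono_neutral_cong_left) (auto simp: set_index_list count_mset count_index_list)
  hence "?N * (\<Prod>i<n. fact (k i)) = fact m"
    using card_permutations_of_multiset_aux[of "mset ?gs"] assms by (simp add: length_index_list)
  hence "real (?N * (\<Prod>i<n. fact (k i))) = real (fact m)" by (rule arg_cong)
  hence "real ?N * (\<Prod>i<n. fact (k i)) = fact m" by simp
  thus ?thesis using card_permutations_of_mset_pos[of ?gs] by (simp add: field_simps)
qed

text \<open>An admissible constant is tested on the monomial form at the unit vectors:
  \<open>F\<close> is the value there and \<open>S\<close> an upper bound for the norm, so
  \<open>c\<close> is at least \<open>F / S\<close>.\<close>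

lemma admissible_imp_ge:
  assumes p: "1 \<le> p" and m: "(\<Sum>i<n. k i) = m" and c: "admissible p n k c"
  shows "(\<Prod>i<n. fact (k i)) / (\<Prod>i<n. ppow p (real (k i)) (real (k i))) * ppow p (real m) (real m) / fact m \<le> c"
proof -
  define gs where "gs = index_list n k"
  have len: "length gs = m" using m by (simp add: gs_def length_index_list)
  have L: "sym_mlin_form p m (monomial_form gs)"
    using sym_mlin_form_monomial_form[OF p, of gs] len by simp
  define S where "S = (\<Prod>i<n. ppow p (real (k i)) (real (k i))) / ppow p (real m) (real m)"
  have S: "S > 0" unfolding S_def by (intro divide_pos_pos prod_pos ppow_pos)
  define F where "F = (\<Prod>i<n. fact (k i)) / (fact m :: real)"
  have F: "F > 0" unfolding F_def by (intro divide_pos_pos prod_pos) auto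
  have "poly_norm p m (monomial_form gs) \<le> S"
    unfolding poly_norm_def
  proof (rule cSup_least)
    show "{\<bar>monomial_form gs (replicate m x)\<bar> |x. in_lp p x \<and> lp_norm p x \<le> 1} \<noteq> {}"
      using unit_seq_lp[OF p, of 0] by auto
    fix v assume "v \<in> {\<bar>monomial_form gs (replicate m x)\<bar> |x. in_lp p x \<and> lp_norm p x \<le> 1}"
    then obtain x where x: "v = \<bar>monomial_form gs (replicate m x)\<bar>" "in_lp p x" "lp_norm p x \<le> 1"
      by auto
    have "monomial_form gs (replicate m x) = (\<Prod>i<n. x i ^ k i)"
      using monomial_form_diagonal[of "{..<n}" gs x] len
      by (auto simp: gs_def set_index_list count_index_list)
    thus "v \<le> S" using abs_monomial_le[OF p x(2,3) m] x(1) by (simp add: S_def)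
  qed
  moreover have "F \<le> c * poly_norm p m (monomial_form gs)"
  proof -
    have "\<bar>monomial_form gs (rep_tuple n k unit_seq)\<bar> \<le> c * poly_norm p m (monomial_form gs)"
      using c L unit_seq_lp[OF p] unfolding admissible_def m by (auto simp: unit_seq_def)
    moreover have "monomial_form gs (rep_tuple n k unit_seq) = F"
      unfolding rep_tuple_eq_map gs_def monomial_form_unit_seq F_def by (rule fact_div_card_index_list[OF m])
    ultimately show ?thesis by simp
  qed
  moreover have "poly_norm p m (monomial_form gs) \<ge> 0" by (rule poly_norm_nonneg[OF p L])
  \<comment> \<open>Since \<open>F > 0\<close> and the norm is nonnegative, \<open>c\<close> must be
    positive, so the norm may be replaced by the larger \<open>S\<close>.\<close>
  ultimately have "F \<le> c * S"
    using F by (smt (verit) mult_left_mono mult_nonneg_nonneg mult_nonpos_nonneg)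
  hence "F / S \<le> c" using S by (simp add: field_simps)
  thus ?thesis by (simp add: F_def S_def field_simps)
qed

text \<open>A real infimum lies below the members of its set once the set is bounded below, which
  \<open>admissible_imp_ge\<close> provides.\<close>

lemma cp_le_admissible:
  assumes "1 \<le> p" "admissible p n k c"
  shows "cp p n k \<le> c"
  unfolding cp_eq_Inf_admissible
  using assms admissible_imp_ge[OF assms(1) refl] by (intro cInf_lower bdd_belowI) auto

theorem mainTheorem6:
  fixes p :: ereal and m n :: nat and k :: "nat \<Rightarrow> nat"
  assumes "1 \<le> p" and "m \<ge> 1" and "(\<Sum>i<n. k i) = m"
  defines "lower \<equiv> (\<Prod>i<n. fact (k i)) / (\<Prod>i<n. ppow p (real (k i)) (real (k i)))
                     * ppow p (real m) (real m) / fact m"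
      and "upper1 \<equiv> (\<Prod>i<n. real (k i) ^ k i) / fact m * ppow p (real n) (real m)"
  shows "(p \<ge> ereal (real m) \<longrightarrow>
           lower \<le> cp p n k \<and>
           (if p = \<infinity> then cp p n k \<le> upper1
            else cp p n k \<le> min upper1
              (real_of_ereal p * 2 powr (real_of_ereal p / 2) * Gamma (real_of_ereal p / 2)
                 * real m powr (real_of_ereal p / 2) / fact m))) \<and>
         (p < ereal (real m) \<longrightarrow>
           lower \<le> cp p n k \<and>
           cp p n k \<le> min upper1
              (real n powr ((real m - real_of_ereal p) / real_of_ereal p) * real m
                 * 2 powr (real m / 2) * Gamma (real m / 2) * real m powr (real m / 2) / fact m))"
proof -
  have m: "m > 0" using assms(2) by simp
  have upper1: "admissible p n k upper1"
    unfolding upper1_def by (rule admissible_upper1[OF assms(1,3) m])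
  have "lower \<le> cp p n k"
    unfolding cp_eq_Inf_admissible
  proof (rule cInf_greatest)
    \<comment> \<open>The real infimum is bounded below by a common lower bound only for a nonempty
      set; the first upper bound is the witness.\<close>
    show "{c. admissible p n k c} \<noteq> {}" using upper1 by blast
    show "lower \<le> c" if "c \<in> {c. admissible p n k c}" for c
      unfolding lower_def using admissible_imp_ge[OF assms(1,3)] that by blast
  qed
  moreover have "cp p n k \<le> upper1"
    by (rule cp_le_admissible[OF assms(1) upper1])
  moreover have "cp p n k \<le> real_of_ereal p * 2 powr (real_of_ereal p / 2) * Gamma (real_of_ereal p / 2)
                 * real m powr (real_of_ereal p / 2) / fact m" if "p \<noteq> \<infinity>" "p \<ge> ereal (real m)"
    using assms(1)
  proof (cases rule: ereal_ge_1_cases)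
    case (real q)
    thus ?thesis
      using cp_le_admissible[OF assms(1)] admissible_upper2_ge[OF real(2) assms(3) m] that by simp
  qed (use that in simp)
  moreover have "cp p n k \<le> real n powr ((real m - real_of_ereal p) / real_of_ereal p) * real m
                 * 2 powr (real m / 2) * Gamma (real m / 2) * real m powr (real m / 2) / fact m"
    if "p < ereal (real m)"
    using assms(1)
  proof (cases rule: ereal_ge_1_cases)
    case (real q)
    thus ?thesis
      using cp_le_admissible[OF assms(1)] admissible_upper2_less[OF real(2) assms(3)] that by simp
  qed (use that in simp)
  ultimately show ?thesis by auto
qed

end
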